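(* Let $S=\{\nu\in\mathbb{R}^4 : F(\nu)=0,\ \|\nu\|=1\}$ with $F(\nu)=(\nu_1^2-\nu_2^2)(\nu_1^2+\nu_4^2)+\nu_1^2\nu_3^2$ be the critical surface in the unit $3$-sphere, and let $L_1,\ldots,L_6$ and $P_1,\ldots,P_6$ be the lines and points of $S$ given in the context. Then: (i) On the lines $L_1,\ldots,L_6$ the surface $S$ has a transverse self-intersection. (ii) At the points $P_1,\ldots,P_6$ the self-intersection is non-transverse. (iii) At each of the points $P_1,\ldots,P_4$ the surface $S$ has a Whitney umbrella singularity. (iv) At the points $P_5$ and $P_6$ curves of self-intersection of $S$ transversely intersect, and $S$ has a self-intersection with coinciding tangent planes of saddle type.
   Context: Notation: $\nu=(\nu_1,\nu_2,\nu_3,\nu_4)$, $\|\cdot\|$ is the Euclidean norm, and $h=\tfrac12\sqrt2$. The lines are the following subsets of the unit $3$-sphere: $L_1$: $\nu_1=\nu_4=0$, $0<\nu_2<h$, $\nu_3>0$; $L_2$: $\nu_1=\nu_4=0$, $-h<\nu_2<0$, $\nu_3>0$; $L_3$: $\nu_1=\nu_4=0$, $0<\nu_2<h$, $\nu_3<0$; $L_4$: $\nu_1=\nu_4=0$, $-h<\nu_2<0$, $\nu_3<0$; $L_5$: $\nu_1=\nu_2=0$, $\nu_4>0$; $L_6$: $\nu_1=\nu_2=0$, $\nu_4<0$. The points are $P_1=(0,h,h,0)$, $P_2=(0,-h,h,0)$, $P_3=(0,h,-h,0)$, $P_4=(0,-h,-h,0)$, $P_5=(0,0,1,0)$, $P_6=(0,0,-1,0)$.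 The terms are understood through local standard forms. For $p\in S$ consider smooth local coordinates $(x,y,z)$ on the $3$-sphere centred at $p$. The surface $S$ has at $p$: - a transverse self-intersection if in some such coordinates $S$ is locally $\{xy=0\}$; - a Whitney umbrella if in some such coordinates $S$ is locally $\{x^2=yz^2\}$; - an intersection of self-intersections, with coinciding tangent planes of saddle type, if in some such coordinates $S$ is locally $\{z^2=x^2y^2\}$, i.e. the union of the two saddle sheets $z=\pm xy$, which have the same tangent plane $z=0$ at $p$ and which meet along the two transversely intersecting curves $x=z=0$ and $y=z=0$. *)

theory Defs
  imports "HOL-Analysis.Analysis"
begin

section \<open>Smooth maps and local coordinates on the unit 3-sphere\<close>

text \<open>On an open set \<open>U\<close> of a Euclidean space, \<open>Ck_on k U f\<close> says that all iterated directional
  derivatives of \<open>f\<close> of order below \<open>k\<close> are differentiable on \<open>U\<close> and those of order \<open>k\<close> are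
  continuous on \<open>U\<close>.\<close>

primrec Ck_on ::
  "nat \<Rightarrow> 'a::euclidean_space set \<Rightarrow> ('a \<Rightarrow> 'b::euclidean_space) \<Rightarrow> bool" where
  "Ck_on 0 U f \<longleftrightarrow> continuous_on U f"
| "Ck_on (Suc k) U f \<longleftrightarrow>
     (\<forall>x\<in>U. f differentiable (at x)) \<and>
     (\<forall>v. Ck_on k U (\<lambda>x. frechet_derivative f (at x) v))"

text \<open>A map on an arbitrary subset \<open>X\<close> is smooth if near each point of \<open>X\<close> it extends to a
  \<open>C\<^sup>\<infinity>\<close> map on an open subset of the ambient space.\<close>

definition smooth_map_on ::
  "'a::euclidean_space set \<Rightarrow> ('a \<Rightarrow> 'b::euclidean_space) \<Rightarrow> bool" where
  "smooth_map_on X f \<longleftrightarrow>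
     (\<forall>x\<in>X. \<exists>U g. open U \<and> x \<in> U \<and> (\<forall>k. Ck_on k U g) \<and> (\<forall>y\<in>X \<inter> U. f y = g y))"

definition diffeomorphism ::
  "'a::euclidean_space set \<Rightarrow> 'b::euclidean_space set \<Rightarrow> ('a \<Rightarrow> 'b) \<Rightarrow> ('b \<Rightarrow> 'a) \<Rightarrow> bool" where
  "diffeomorphism X Y f g \<longleftrightarrow>
     homeomorphism X Y f g \<and> smooth_map_on X f \<and> smooth_map_on Y g"

definition local_coordinates_at ::
  "real^4 \<Rightarrow> (real^4) set \<Rightarrow> (real^4 \<Rightarrow> real^3) \<Rightarrow> bool" where
  "local_coordinates_at p U \<phi> \<longleftrightarrow>
     openin (top_of_set (sphere 0 1)) U \<and> p \<in> U \<and> \<phi> p = 0 \<and>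
     (\<exists>V \<psi>. open V \<and> diffeomorphism U V \<phi> \<psi>)"

text \<open>\<open>locally_given_by S p M\<close>: in some smooth local coordinates on the 3-sphere centred at \<open>p\<close>,
  the set \<open>S\<close> is locally \<open>M\<close>. The coordinate domain may be arbitrarily small.\<close>

definition locally_given_by :: "(real^4) set \<Rightarrow> real^4 \<Rightarrow> (real^3) set \<Rightarrow> bool" where
  "locally_given_by S p M \<longleftrightarrow>
     (\<exists>U \<phi>. local_coordinates_at p U \<phi> \<and> (\<forall>\<nu>\<in>U. \<nu> \<in> S \<longleftrightarrow> \<phi> \<nu> \<in> M))"

section \<open>Local standard forms, with coordinates \<open>(x, y, z) = (w $ 1, w $ 2, w $ 3)\<close>\<close>

definition transverse_self_intersection :: "(real^4) set \<Rightarrow> real^4 \<Rightarrow> bool" where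
  "transverse_self_intersection S p \<longleftrightarrow> locally_given_by S p {w. w$1 * w$2 = 0}"

definition whitney_umbrella :: "(real^4) set \<Rightarrow> real^4 \<Rightarrow> bool" where
  "whitney_umbrella S p \<longleftrightarrow> locally_given_by S p {w. (w$1)\<^sup>2 = w$2 * (w$3)\<^sup>2}"

definition saddle_self_intersection :: "(real^4) set \<Rightarrow> real^4 \<Rightarrow> bool" where
  "saddle_self_intersection S p \<longleftrightarrow>
     locally_given_by S p {w. (w$3)\<^sup>2 = (w$1)\<^sup>2 * (w$2)\<^sup>2}"

text \<open>The curves of self-intersection together with their limit points, such as the pinch point
  of a Whitney umbrella, where the self-intersection is no longer transverse.\<close>

definition self_intersection_locus :: "(real^4) set \<Rightarrow> (real^4) set" where
  "self_intersection_locus S = closure {p. transverse_self_intersection S p}"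

definition nontransverse_self_intersection :: "(real^4) set \<Rightarrow> real^4 \<Rightarrow> bool" where
  "nontransverse_self_intersection S p \<longleftrightarrow>
     p \<in> self_intersection_locus S \<and> \<not> transverse_self_intersection S p"

text \<open>Near \<open>p\<close> the self-intersection locus consists of the two curves \<open>x = z = 0\<close> and
  \<open>y = z = 0\<close>, whose tangent lines at \<open>p\<close> are distinct.\<close>

definition self_intersection_curves_cross_transversely ::
  "(real^4) set \<Rightarrow> real^4 \<Rightarrow> bool" where
  "self_intersection_curves_cross_transversely S p \<longleftrightarrow>
     locally_given_by (self_intersection_locus S) p
       {w. (w$1 = 0 \<and> w$3 = 0) \<or> (w$2 = 0 \<and> w$3 = 0)}"

section \<open>The critical surface, its lines and its points\<close>

definition F :: "real^4 \<Rightarrow> real" where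
  "F \<nu> = ((\<nu>$1)\<^sup>2 - (\<nu>$2)\<^sup>2) * ((\<nu>$1)\<^sup>2 + (\<nu>$4)\<^sup>2) + (\<nu>$1)\<^sup>2 * (\<nu>$3)\<^sup>2"

definition critical_surface :: "(real^4) set" where
  "critical_surface = {\<nu>. F \<nu> = 0 \<and> norm \<nu> = 1}"

definition h :: real where "h = sqrt 2 / 2"

definition L1 :: "(real^4) set" where
  "L1 = {\<nu>. norm \<nu> = 1 \<and> \<nu>$1 = 0 \<and> \<nu>$4 = 0 \<and> 0 < \<nu>$2 \<and> \<nu>$2 < h \<and> \<nu>$3 > 0}"
definition L2 :: "(real^4) set" where
  "L2 = {\<nu>. norm \<nu> = 1 \<and> \<nu>$1 = 0 \<and> \<nu>$4 = 0 \<and> - h < \<nu>$2 \<and> \<nu>$2 < 0 \<and> \<nu>$3 > 0}"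
definition L3 :: "(real^4) set" where
  "L3 = {\<nu>. norm \<nu> = 1 \<and> \<nu>$1 = 0 \<and> \<nu>$4 = 0 \<and> 0 < \<nu>$2 \<and> \<nu>$2 < h \<and> \<nu>$3 < 0}"
definition L4 :: "(real^4) set" where
  "L4 = {\<nu>. norm \<nu> = 1 \<and> \<nu>$1 = 0 \<and> \<nu>$4 = 0 \<and> - h < \<nu>$2 \<and> \<nu>$2 < 0 \<and> \<nu>$3 < 0}"
definition L5 :: "(real^4) set" where
  "L5 = {\<nu>. norm \<nu> = 1 \<and> \<nu>$1 = 0 \<and> \<nu>$2 = 0 \<and> \<nu>$4 > 0}"
definition L6 :: "(real^4) set" where
  "L6 = {\<nu>. norm \<nu> = 1 \<and> \<nu>$1 = 0 \<and> \<nu>$2 = 0 \<and> \<nu>$4 < 0}"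

definition P1 :: "real^4" where "P1 = vector [0, h, h, 0]"
definition P2 :: "real^4" where "P2 = vector [0, - h, h, 0]"
definition P3 :: "real^4" where "P3 = vector [0, h, - h, 0]"
definition P4 :: "real^4" where "P4 = vector [0, - h, - h, 0]"
definition P5 :: "real^4" where "P5 = vector [0, 0, 1, 0]"
definition P6 :: "real^4" where "P6 = vector [0, 0, - 1, 0]"

end

theory Submission
  imports Defs
begin

text \<open>On the unit sphere the relation \<open>\<nu>\<^sub>3\<^sup>2 = 1 - \<nu>\<^sub>1\<^sup>2 - \<nu>\<^sub>2\<^sup>2 - \<nu>\<^sub>4\<^sup>2\<close> turns the equation of the
  surface into \<open>\<nu>\<^sub>1\<^sup>2 (1 - 2 \<nu>\<^sub>2\<^sup>2) = \<nu>\<^sub>2\<^sup>2 \<nu>\<^sub>4\<^sup>2\<close> (\<open>critical_surface_iff\<close>). All the standard forms can be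
  read off from this equation. Put \<open>s = sqrt (1 - 2 \<nu>\<^sub>2\<^sup>2)\<close>, which is smooth and positive where
  \<open>\<bar>\<nu>\<^sub>2\<bar> < h\<close>.

  \<^item> Where \<open>\<nu>\<^sub>2 \<noteq> 0\<close>, the factors of \<open>(\<nu>\<^sub>1 s - \<nu>\<^sub>2 \<nu>\<^sub>4) (\<nu>\<^sub>1 s + \<nu>\<^sub>2 \<nu>\<^sub>4) = 0\<close> are two coordinates near
    the curve \<open>\<nu>\<^sub>1 = \<nu>\<^sub>4 = 0\<close>; after division by \<open>\<nu>\<^sub>4\<^sup>2\<close>, so are those of
    \<open>(\<nu>\<^sub>1 s / \<nu>\<^sub>4 - \<nu>\<^sub>2) (\<nu>\<^sub>1 s / \<nu>\<^sub>4 + \<nu>\<^sub>2) = 0\<close> near \<open>\<nu>\<^sub>1 = \<nu>\<^sub>2 = 0\<close>, \<open>\<nu>\<^sub>4 \<noteq> 0\<close>.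
  \<^item> At \<open>\<nu>\<^sub>2 = \<plusminus>h\<close> the quantity \<open>1 - 2 \<nu>\<^sub>2\<^sup>2\<close> is itself a coordinate, and
    \<open>(\<nu>\<^sub>2 \<nu>\<^sub>4)\<^sup>2 = (1 - 2 \<nu>\<^sub>2\<^sup>2) \<nu>\<^sub>1\<^sup>2\<close> is a Whitney umbrella.
  \<^item> At \<open>\<nu>\<^sub>3 = \<plusminus>1\<close> the equation \<open>(\<nu>\<^sub>1 s)\<^sup>2 = \<nu>\<^sub>2\<^sup>2 \<nu>\<^sub>4\<^sup>2\<close> is the pair of saddles.

  Each of these coordinate systems has an inverse given by a closed formula built from arithmetic
  and square roots of positive functions, so that diffeomorphy needs only the closure properties
  of smooth functions and no inverse function theorem.

  That a point is not a transverse self-intersection is always shown by the same criterion,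
  \<open>not_transverse_if_flat\<close>: the set \<open>xy = 0\<close> contains the three coordinate axes, so the velocities of
  differentiable curves in \<open>S\<close> through a transverse self-intersection span the whole
  tangent space of the sphere, whereas at the points in question they all lie in a plane. This
  settles the pinch points (plane \<open>\<nu>\<^sub>4 = 0\<close>), the poles \<open>\<nu>\<^sub>3 = \<plusminus>1\<close> (plane \<open>\<nu>\<^sub>1 = 0\<close>) and the regular
  points with \<open>\<nu>\<^sub>1 \<noteq> 0\<close> (tangent plane of the surface). The last case shows that near a pole the
  self-intersection locus contains nothing besides the two curves; conversely the limit points of
  the lines belong to it because they are endpoints of arcs of the meridian \<open>\<nu>\<^sub>1 = \<nu>\<^sub>4 = 0\<close>.\<close>

section \<open>Calculus of smooth maps\<close>

lemma Ck_on_cong: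
  assumes "open U" "\<And>x. x \<in> U \<Longrightarrow> f x = g x" "Ck_on k U f"
  shows "Ck_on k U g"
  using assms(2,3)
proof (induction k arbitrary: f g)
  case 0
  then show ?case using continuous_on_cong by (metis Ck_on.simps(1))
next
  case (Suc k)
  have d: "f differentiable (at x)" if "x \<in> U" for x
    using Suc.prems that by simp
  have "g differentiable (at x)" if "x \<in> U" for x
    using d[OF that] that Suc.prems(1) assms(1)
    by (metis differentiable_def has_derivative_transform_within_open)
  moreover have "Ck_on k U (\<lambda>x. frechet_derivative g (at x) v)" for v
  proof (rule Suc.IH)
    show "frechet_derivative f (at x) v = frechet_derivative g (at x) v" if "x \<in> U" for x
      using frechet_derivative_transform_within_open[OF d assms(1) _ Suc.prems(1)] that by metis
    show "Ck_on k U (\<lambda>x. frechet_derivative f (at x) v)"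
      using Suc.prems by simp
  qed
  ultimately show ?case by simp
qed

text \<open>The class \<open>Ck_on\<close> is defined through \<open>frechet_derivative\<close>, an indefinite choice. On an open set
  any known derivative may be used instead, which makes the differentiation rules applicable in
  inductions on the order.\<close>

lemma Ck_on_SucI:
  assumes "open U" "\<And>x. x \<in> U \<Longrightarrow> (f has_derivative f' x) (at x)"
    "\<And>v. Ck_on k U (\<lambda>x. f' x v)"
  shows "Ck_on (Suc k) U f"
proof -
  have eq: "f' x = frechet_derivative f (at x)" if "x \<in> U" for x
    using frechet_derivative_at assms(2) that by blast
  have "Ck_on k U (\<lambda>x. frechet_derivative f (at x) v)" for v
    by (rule Ck_on_cong[OF assms(1) _ assms(3)[of v]]) (simp add: eq)
  then show ?thesis using assms(2) by (auto simp: differentiable_def)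
qed

lemma Ck_on_SucD:
  assumes "Ck_on (Suc k) U f"
  obtains f' where "\<And>x. x \<in> U \<Longrightarrow> (f has_derivative f' x) (at x)"
    "\<And>v. Ck_on k U (\<lambda>x. f' x v)"
  using assms that[of "\<lambda>x. frechet_derivative f (at x)"] frechet_derivative_works
  by auto

lemma Ck_on_Suc_imp_Ck_on: "Ck_on (Suc k) U f \<Longrightarrow> Ck_on k U f"
proof (induction k arbitrary: f)
  case 0
  then show ?case
    by (auto intro!: continuous_at_imp_continuous_on differentiable_imp_continuous_within)
next
  case (Suc k)
  then show ?case by auto
qed

lemma Ck_on_subset: "Ck_on k U f \<Longrightarrow> V \<subseteq> U \<Longrightarrow> Ck_on k V f"
  by (induction k arbitrary: f) (auto intro: continuous_on_subset)

lemma Ck_on_const: "open U \<Longrightarrow> Ck_on k U (\<lambda>x. c)"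
  by (induction k arbitrary: c) (auto intro!: Ck_on_SucI[where f' = "\<lambda>x v. 0"])

lemma Ck_on_bounded_linear: "open U \<Longrightarrow> bounded_linear f \<Longrightarrow> Ck_on k U f"
  by (cases k) (auto simp: linear_continuous_on simp del: Ck_on.simps(2)
      intro!: Ck_on_SucI[where f' = "\<lambda>x. f"] bounded_linear_imp_has_derivative Ck_on_const)

lemma Ck_on_bounded_linear_compose:
  assumes "open U" "bounded_linear L"
  shows "Ck_on k U f \<Longrightarrow> Ck_on k U (\<lambda>x. L (f x))"
proof (induction k arbitrary: f)
  case 0
  then show ?case using bounded_linear.continuous_on[OF assms(2)] by simp
next
  case (Suc k)
  obtain f' where f': "\<And>x. x \<in> U \<Longrightarrow> (f has_derivative f' x) (at x)"
    "\<And>v. Ck_on k U (\<lambda>x. f' x v)"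
    using Ck_on_SucD[OF Suc.prems] by blast
  show ?case
    by (rule Ck_on_SucI[OF assms(1) bounded_linear.has_derivative[OF assms(2) f'(1)]
          Suc.IH[OF f'(2)]])
qed

lemma Ck_on_add:
  assumes "open U"
  shows "Ck_on k U f \<Longrightarrow> Ck_on k U g \<Longrightarrow> Ck_on k U (\<lambda>x. f x + g x)"
proof (induction k arbitrary: f g)
  case 0
  then show ?case by (simp add: continuous_on_add)
next
  case (Suc k)
  obtain f' where f': "\<And>x. x \<in> U \<Longrightarrow> (f has_derivative f' x) (at x)"
    "\<And>v. Ck_on k U (\<lambda>x. f' x v)"
    using Ck_on_SucD[OF Suc.prems(1)] by blast
  obtain g' where g': "\<And>x. x \<in> U \<Longrightarrow> (g has_derivative g' x) (at x)"
    "\<And>v. Ck_on k U (\<lambda>x. g' x v)"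
    using Ck_on_SucD[OF Suc.prems(2)] by blast
  show ?case
    by (rule Ck_on_SucI[OF assms has_derivative_add[OF f'(1) g'(1)] Suc.IH[OF f'(2) g'(2)]])
qed

lemma Ck_on_mult:
  fixes f g :: "'a::euclidean_space \<Rightarrow> real"
  assumes "open U"
  shows "Ck_on k U f \<Longrightarrow> Ck_on k U g \<Longrightarrow> Ck_on k U (\<lambda>x. f x * g x)"
proof (induction k arbitrary: f g)
  case 0
  then show ?case by (simp add: continuous_on_mult)
next
  case (Suc k)
  obtain f' where f': "\<And>x. x \<in> U \<Longrightarrow> (f has_derivative f' x) (at x)"
    "\<And>v. Ck_on k U (\<lambda>x. f' x v)"
    using Ck_on_SucD[OF Suc.prems(1)] by blast
  obtain g' where g': "\<And>x. x \<in> U \<Longrightarrow> (g has_derivative g' x) (at x)"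
    "\<And>v. Ck_on k U (\<lambda>x. g' x v)"
    using Ck_on_SucD[OF Suc.prems(2)] by blast
  have "Ck_on k U f" "Ck_on k U g"
    using Suc.prems Ck_on_Suc_imp_Ck_on by blast+
  then show ?case
    by (intro Ck_on_SucI[OF assms has_derivative_mult[OF f'(1) g'(1)]]
        Ck_on_add assms Suc.IH f'(2) g'(2))
qed

text \<open>The derivative of \<open>1 / f\<close> is a polynomial in \<open>1 / f\<close> and the derivative of \<open>f\<close>, so the induction
  hypothesis for \<open>1 / f\<close> one order lower suffices. The square root below works in the same way, its
  derivative involving \<open>1 / sqrt f\<close>.\<close>

lemma Ck_on_inverse:
  fixes f :: "'a::euclidean_space \<Rightarrow> real"
  assumes "open U" "\<And>x. x \<in> U \<Longrightarrow> f x \<noteq> 0"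
  shows "Ck_on k U f \<Longrightarrow> Ck_on k U (\<lambda>x. inverse (f x))"
proof (induction k)
  case 0
  then show ?case using assms by (simp add: continuous_on_inverse)
next
  case (Suc k)
  obtain f' where f': "\<And>x. x \<in> U \<Longrightarrow> (f has_derivative f' x) (at x)"
    "\<And>v. Ck_on k U (\<lambda>x. f' x v)"
    using Ck_on_SucD[OF Suc.prems] by blast
  have i: "Ck_on k U (\<lambda>x. inverse (f x))"
    using Suc Ck_on_Suc_imp_Ck_on by blast
  show ?case
  proof (rule Ck_on_SucI[OF assms(1)])
    show "((\<lambda>x. inverse (f x)) has_derivative
        (\<lambda>v. - 1 * (inverse (f x) * f' x v * inverse (f x)))) (at x)" if "x \<in> U" for x
      using Deriv.has_derivative_inverse[OF assms(2)[OF that] f'(1)[OF that]] by simp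
    show "Ck_on k U (\<lambda>x. - 1 * (inverse (f x) * f' x v * inverse (f x)))" for v
      by (intro Ck_on_mult assms(1) i f'(2) Ck_on_const)
  qed
qed

lemma Ck_on_sqrt:
  fixes f :: "'a::euclidean_space \<Rightarrow> real"
  assumes "open U" "\<And>x. x \<in> U \<Longrightarrow> f x > 0"
  shows "Ck_on k U f \<Longrightarrow> Ck_on k U (\<lambda>x. sqrt (f x))"
proof (induction k)
  case 0
  then show ?case by (simp add: continuous_on_real_sqrt)
next
  case (Suc k)
  obtain f' where f': "\<And>x. x \<in> U \<Longrightarrow> (f has_derivative f' x) (at x)"
    "\<And>v. Ck_on k U (\<lambda>x. f' x v)"
    using Ck_on_SucD[OF Suc.prems] by blast
  have i: "Ck_on k U (\<lambda>x. inverse (sqrt (f x)))"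
  proof (rule Ck_on_inverse[OF assms(1)])
    show "sqrt (f x) \<noteq> 0" if "x \<in> U" for x
      using assms(2)[OF that] by simp
    show "Ck_on k U (\<lambda>x. sqrt (f x))"
      using Suc Ck_on_Suc_imp_Ck_on by blast
  qed
  show ?case
  proof (rule Ck_on_SucI[OF assms(1)])
    show "((\<lambda>x. sqrt (f x)) has_derivative
        (\<lambda>v. f' x v * (inverse (sqrt (f x)) * (1/2)))) (at x)" if "x \<in> U" for x
      using assms(2)[OF that] f'(1)[OF that]
      by (auto intro!: derivative_eq_intros simp: field_simps)
    show "Ck_on k U (\<lambda>x. f' x v * (inverse (sqrt (f x)) * (1/2)))" for v
      by (intro Ck_on_mult assms(1) i f'(2) Ck_on_const)
  qed
qed

text \<open>Openness of the domain is part of the notion, because it is what makes derivatives on the domain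
  unique.\<close>

definition smooth_on :: "'a::euclidean_space set \<Rightarrow> ('a \<Rightarrow> 'b::euclidean_space) \<Rightarrow> bool" where
  "smooth_on U f \<longleftrightarrow> open U \<and> (\<forall>k. Ck_on k U f)"

lemma smooth_on_subset: "smooth_on U f \<Longrightarrow> open V \<Longrightarrow> V \<subseteq> U \<Longrightarrow> smooth_on V f"
  by (auto simp: smooth_on_def intro: Ck_on_subset)

lemma smooth_on_const: "open U \<Longrightarrow> smooth_on U (\<lambda>x. c)"
  by (simp add: smooth_on_def Ck_on_const)

lemma smooth_on_nth: "open U \<Longrightarrow> smooth_on U (\<lambda>x. x $ i)"
  by (simp add: smooth_on_def Ck_on_bounded_linear bounded_linear_vec_nth)

lemma smooth_on_add: "smooth_on U f \<Longrightarrow> smooth_on U g \<Longrightarrow> smooth_on U (\<lambda>x. f x + g x)"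
  by (simp add: smooth_on_def Ck_on_add)

lemma smooth_on_mult:
  fixes f g :: "'a::euclidean_space \<Rightarrow> real"
  shows "smooth_on U f \<Longrightarrow> smooth_on U g \<Longrightarrow> smooth_on U (\<lambda>x. f x * g x)"
  by (simp add: smooth_on_def Ck_on_mult)

lemma smooth_on_diff: "smooth_on U f \<Longrightarrow> smooth_on U g \<Longrightarrow> smooth_on U (\<lambda>x. f x - g x)"
  using smooth_on_add[of U f "\<lambda>x. - g x"]
    Ck_on_bounded_linear_compose[OF _ bounded_linear_minus[OF bounded_linear_ident]]
  by (auto simp: smooth_on_def)

lemma smooth_on_power2:
  fixes f :: "'a::euclidean_space \<Rightarrow> real"
  shows "smooth_on U f \<Longrightarrow> smooth_on U (\<lambda>x. (f x)\<^sup>2)"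
  by (simp add: power2_eq_square smooth_on_mult)

lemma smooth_on_divide:
  fixes f g :: "'a::euclidean_space \<Rightarrow> real"
  assumes "smooth_on U f" "smooth_on U g" "\<And>x. x \<in> U \<Longrightarrow> g x \<noteq> 0"
  shows "smooth_on U (\<lambda>x. f x / g x)"
  using assms by (simp add: smooth_on_def Ck_on_mult Ck_on_inverse divide_inverse)

lemma smooth_on_sqrt:
  fixes f :: "'a::euclidean_space \<Rightarrow> real"
  shows "smooth_on U f \<Longrightarrow> (\<And>x. x \<in> U \<Longrightarrow> f x > 0) \<Longrightarrow> smooth_on U (\<lambda>x. sqrt (f x))"
  by (simp add: smooth_on_def Ck_on_sqrt)

lemma smooth_on_scaleR_const:
  fixes f :: "'a::euclidean_space \<Rightarrow> real"
  shows "smooth_on U f \<Longrightarrow> smooth_on U (\<lambda>x. f x *\<^sub>R c)"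
  by (simp add: smooth_on_def Ck_on_bounded_linear_compose[OF _ bounded_linear_scaleR_left])

lemma vector_4 [simp]:
  "(vector [a, b, c, d] :: 'a::zero^4) $ 1 = a" "(vector [a, b, c, d] :: 'a^4) $ 2 = b"
  "(vector [a, b, c, d] :: 'a^4) $ 3 = c" "(vector [a, b, c, d] :: 'a^4) $ 4 = d"
  by (simp_all add: vector_def)

lemma smooth_on_vector3:
  assumes "smooth_on U a" "smooth_on U b" "smooth_on U c"
  shows "smooth_on U (\<lambda>x. vector [a x, b x, c x] :: real^3)"
proof -
  have "(vector [x, y, z] :: real^3) = x *\<^sub>R axis 1 1 + y *\<^sub>R axis 2 1 + z *\<^sub>R axis 3 1" for x y z
    by (simp add: vec_eq_iff forall_3 axis_def)
  then show ?thesis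
    using assms by (simp add: smooth_on_add smooth_on_scaleR_const)
qed

lemma smooth_on_vector4:
  assumes "smooth_on U a" "smooth_on U b" "smooth_on U c" "smooth_on U d"
  shows "smooth_on U (\<lambda>x. vector [a x, b x, c x, d x] :: real^4)"
proof -
  have "(vector [x, y, z, w] :: real^4)
      = x *\<^sub>R axis 1 1 + y *\<^sub>R axis 2 1 + z *\<^sub>R axis 3 1 + w *\<^sub>R axis 4 1" for x y z w
    by (simp add: vec_eq_iff forall_4 axis_def)
  then show ?thesis
    using assms by (simp add: smooth_on_add smooth_on_scaleR_const)
qed

lemmas smooth_on_intros = smooth_on_const smooth_on_nth smooth_on_add smooth_on_diff
  smooth_on_mult smooth_on_power2 smooth_on_divide smooth_on_sqrt smooth_on_vector3 smooth_on_vector4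

section \<open>Coordinates given by explicit inverses\<close>

text \<open>Coordinates of the sphere come from a smooth map on an open subset of the ambient space together
  with a smooth parametrisation of its trace on the sphere. Checking that the two are inverse to each
  other is then a computation, and the homeomorphism condition follows from smoothness.\<close>

lemma local_coordinates_atI:
  assumes \<phi>: "smooth_on \<Omega> \<phi>" and \<psi>: "smooth_on V \<psi>"
    and p: "p \<in> \<Omega>" "norm p = 1" "\<phi> p = 0"
    and left: "\<And>\<nu>. \<nu> \<in> \<Omega> \<Longrightarrow> norm \<nu> = 1 \<Longrightarrow> \<phi> \<nu> \<in> V \<and> \<psi> (\<phi> \<nu>) = \<nu>"
    and right: "\<And>w. w \<in> V \<Longrightarrow> \<psi> w \<in> \<Omega> \<and> norm (\<psi> w) = 1 \<and> \<phi> (\<psi> w) = w"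
  shows "local_coordinates_at p (sphere 0 1 \<inter> \<Omega>) \<phi>"
proof -
  let ?U = "sphere 0 1 \<inter> \<Omega>"
  have op: "open \<Omega>" "open V"
    using \<phi> \<psi> by (simp_all add: smooth_on_def)
  have cont: "continuous_on ?U \<phi>" "continuous_on V \<psi>"
    using \<phi> \<psi> unfolding smooth_on_def by (metis Ck_on.simps(1) continuous_on_subset Int_lower2)+
  have eq: "\<phi> ` ?U = V"
    using left right by (force simp: image_iff)
  moreover have "\<psi> ` V = ?U"
    using left right by (force simp: image_iff)
  ultimately have "homeomorphism ?U V \<phi> \<psi>"
    unfolding homeomorphism_def using cont left right by auto
  moreover have "smooth_map_on ?U \<phi>" "smooth_map_on V \<psi>"
    unfolding smooth_map_on_def using \<phi> \<psi> op by (auto simp: smooth_on_def)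
  ultimately have "diffeomorphism ?U V \<phi> \<psi>"
    by (simp add: diffeomorphism_def)
  then show ?thesis
    unfolding local_coordinates_at_def using p op by (auto intro: openin_open_Int)
qed

lemma locally_given_byI:
  assumes "smooth_on \<Omega> \<phi>" "smooth_on V \<psi>"
    and "p \<in> \<Omega>" "norm p = 1" "\<phi> p = 0"
    and "\<And>\<nu>. \<nu> \<in> \<Omega> \<Longrightarrow> norm \<nu> = 1 \<Longrightarrow> \<phi> \<nu> \<in> V \<and> \<psi> (\<phi> \<nu>) = \<nu>"
    and "\<And>w. w \<in> V \<Longrightarrow> \<psi> w \<in> \<Omega> \<and> norm (\<psi> w) = 1 \<and> \<phi> (\<psi> w) = w"
    and "\<And>\<nu>. \<nu> \<in> \<Omega> \<Longrightarrow> norm \<nu> = 1 \<Longrightarrow> \<nu> \<in> S \<longleftrightarrow> \<phi> \<nu> \<in> M"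
  shows "locally_given_by S p M"
  unfolding locally_given_by_def
  using local_coordinates_atI[OF assms(1-7)] assms(8) by fastforce

section \<open>The surface in coordinates\<close>

lemma norm_eq_1_iff_real4:
  fixes \<nu> :: "real^4"
  shows "norm \<nu> = 1 \<longleftrightarrow> (\<nu>$1)\<^sup>2 + (\<nu>$2)\<^sup>2 + (\<nu>$3)\<^sup>2 + (\<nu>$4)\<^sup>2 = 1"
  by (simp add: norm_eq_1 inner_vec_def sum_4 power2_eq_square)

text \<open>Eliminating \<open>\<nu>\<^sub>3\<close> leaves an equation in the three squares \<open>\<nu>\<^sub>1\<^sup>2\<close>, \<open>\<nu>\<^sub>2\<^sup>2\<close>, \<open>\<nu>\<^sub>4\<^sup>2\<close> from which
  all local standard forms are visible.\<close>

lemma critical_surface_iff: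
  assumes "norm \<nu> = 1"
  shows "\<nu> \<in> critical_surface \<longleftrightarrow> (\<nu>$1)\<^sup>2 * (1 - 2 * (\<nu>$2)\<^sup>2) = (\<nu>$2)\<^sup>2 * (\<nu>$4)\<^sup>2"
proof -
  have c: "(\<nu>$3)\<^sup>2 = 1 - (\<nu>$1)\<^sup>2 - (\<nu>$2)\<^sup>2 - (\<nu>$4)\<^sup>2"
    using assms by (simp add: norm_eq_1_iff_real4)
  have "F \<nu> = (\<nu>$1)\<^sup>2 * (1 - 2 * (\<nu>$2)\<^sup>2) - (\<nu>$2)\<^sup>2 * (\<nu>$4)\<^sup>2"
    unfolding F_def c by algebra
  then show ?thesis using assms by (simp add: critical_surface_def)
qed

text \<open>The charts recover a coordinate from its square. A sign \<open>\<sigma>\<close>, encoded as a number of square 1,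
  selects the hemisphere, so that symmetric points share one proof.\<close>

lemma signed_sqrt:
  fixes \<sigma> :: real
  assumes "\<sigma>\<^sup>2 = 1"
  shows "\<sigma> * c > 0 \<Longrightarrow> \<sigma> * sqrt (c\<^sup>2) = c" "(\<sigma> * sqrt q)\<^sup>2 = \<bar>q\<bar>"
    "q > 0 \<Longrightarrow> \<sigma> * (\<sigma> * sqrt q) > 0"
proof -
  have "\<sigma> = 1 \<or> \<sigma> = -1" using assms by (simp add: power2_eq_1_iff)
  then show "\<sigma> * c > 0 \<Longrightarrow> \<sigma> * sqrt (c\<^sup>2) = c" "q > 0 \<Longrightarrow> \<sigma> * (\<sigma> * sqrt q) > 0"
    by auto
  show "(\<sigma> * sqrt q)\<^sup>2 = \<bar>q\<bar>"
    using assms by (simp add: power_mult_distrib flip: real_sqrt_power)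
qed

lemma ex_sign: "c \<noteq> 0 \<Longrightarrow> \<exists>\<sigma>::real. \<sigma>\<^sup>2 = 1 \<and> \<sigma> * c > 0"
  by (rule exI[of _ "sgn c"]) (auto simp: sgn_if)

text \<open>With \<open>x = \<nu>\<^sub>2 \<nu>\<^sub>4\<close>, \<open>y = 1 - 2 \<nu>\<^sub>2\<^sup>2\<close> and \<open>z = \<nu>\<^sub>1\<close> the equation is literally \<open>x\<^sup>2 = y z\<^sup>2\<close>. These are
  coordinates because \<open>\<nu>\<^sub>2\<close> does not vanish and can be recovered from \<open>y\<close>.\<close>

lemma whitney_umbrella_at:
  assumes \<sigma>: "\<sigma>\<^sup>2 = 1" and \<beta>: "\<beta>\<^sup>2 = 1"
  shows "whitney_umbrella critical_surface (vector [0, \<beta> * h, \<sigma> * h, 0])"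
  unfolding whitney_umbrella_def
proof (rule locally_given_byI)
  let ?p = "vector [0, \<beta> * h, \<sigma> * h, 0] :: real^4"
  define \<Omega> where "\<Omega> = {\<nu>::real^4. \<beta> * \<nu>$2 > 0 \<and> \<sigma> * \<nu>$3 > 0}"
  define \<phi> :: "real^4 \<Rightarrow> real^3"
    where "\<phi> = (\<lambda>\<nu>. vector [\<nu>$2 * \<nu>$4, 1 - 2 * (\<nu>$2)\<^sup>2, \<nu>$1])"
  define b where "b = (\<lambda>w::real^3. \<beta> * sqrt ((1 - w$2) / 2))"
  define q where "q = (\<lambda>w. 1 - (w$3)\<^sup>2 - (b w)\<^sup>2 - (w$1 / b w)\<^sup>2)"
  define \<psi> :: "real^3 \<Rightarrow> real^4"
    where "\<psi> = (\<lambda>w. vector [w$3, b w, \<sigma> * sqrt (q w), w$1 / b w])"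
  \<comment> \<open>The second condition is \<open>q w > 0\<close>, cleared of denominators so that \<open>V\<close> is visibly open.\<close>
  define V where "V = {w::real^3. w$2 < 1 \<and> (1 - w$2) * (1 - (w$3)\<^sup>2 - (1 - w$2) / 2) > 2 * (w$1)\<^sup>2}"
  have h: "h > 0" "h\<^sup>2 = 1/2" by (simp_all add: h_def power_divide)
  have "open \<Omega>" unfolding \<Omega>_def by (intro open_Collect_conj open_Collect_less continuous_intros)
  have "open V" unfolding V_def by (intro open_Collect_conj open_Collect_less continuous_intros) auto
  have b: "\<beta> * b w > 0" "b w \<noteq> 0" "(b w)\<^sup>2 = (1 - w$2) / 2" "q w > 0" if "w \<in> V" for w
  proof -
    have w: "w$2 < 1" using that by (simp add: V_def)
    show "\<beta> * b w > 0" unfolding b_def using w by (intro signed_sqrt(3) \<beta>) simp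
    then show "b w \<noteq> 0" by auto
    show b2: "(b w)\<^sup>2 = (1 - w$2) / 2"
      unfolding b_def using w signed_sqrt(2)[OF \<beta>] by simp
    show "q w > 0"
      using w that unfolding q_def V_def power_divide b2 by (simp add: field_simps)
  qed
  show "smooth_on \<Omega> \<phi>"
    unfolding \<phi>_def using \<open>open \<Omega>\<close> by (intro smooth_on_intros)
  have sb: "smooth_on V b"
    unfolding b_def using \<open>open V\<close> by (intro smooth_on_intros) (auto simp: V_def)
  have "smooth_on V q"
    unfolding q_def using \<open>open V\<close> sb b by (intro smooth_on_intros) auto
  then show "smooth_on V \<psi>"
    unfolding \<psi>_def using \<open>open V\<close> sb b by (intro smooth_on_intros) auto
  show "?p \<in> \<Omega>" "norm ?p = 1" "\<phi> ?p = 0"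
    using \<sigma> \<beta> h
    by (simp_all add: \<Omega>_def \<phi>_def norm_eq_1_iff_real4 power_mult_distrib vec_eq_iff forall_3
        mult.assoc[symmetric] power2_eq_square[of \<sigma>, symmetric] power2_eq_square[of \<beta>, symmetric])
  show "\<phi> \<nu> \<in> V \<and> \<psi> (\<phi> \<nu>) = \<nu>" if "\<nu> \<in> \<Omega>" "norm \<nu> = 1" for \<nu>
  proof -
    have pos: "\<beta> * \<nu>$2 > 0" "\<sigma> * \<nu>$3 > 0" using that by (auto simp: \<Omega>_def)
    then have nz: "\<nu>$2 \<noteq> 0" "\<nu>$3 \<noteq> 0" by auto
    have c: "1 - (\<nu>$1)\<^sup>2 - (\<nu>$2)\<^sup>2 - (\<nu>$4)\<^sup>2 = (\<nu>$3)\<^sup>2"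
      using that by (simp add: norm_eq_1_iff_real4)
    have bb: "b (\<phi> \<nu>) = \<nu>$2"
      using signed_sqrt(1)[OF \<beta> pos(1)] by (simp add: b_def \<phi>_def)
    have qq: "q (\<phi> \<nu>) = (\<nu>$3)\<^sup>2"
      unfolding q_def bb c[symmetric] using nz by (simp add: \<phi>_def)
    have "2 * (\<nu>$2)\<^sup>2 * (\<nu>$3)\<^sup>2 > 0" using nz by simp
    then have "\<phi> \<nu> \<in> V"
      using nz unfolding c[symmetric] by (simp add: V_def \<phi>_def algebra_simps power_mult_distrib)
    moreover have "\<psi> (\<phi> \<nu>) = \<nu>"
      unfolding \<psi>_def bb qq signed_sqrt(1)[OF \<sigma> pos(2)]
      using nz by (simp add: vec_eq_iff forall_4 \<phi>_def)
    ultimately show ?thesis ..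
  qed
  show "\<psi> w \<in> \<Omega> \<and> norm (\<psi> w) = 1 \<and> \<phi> (\<psi> w) = w" if "w \<in> V" for w
    using b[OF that] signed_sqrt(2,3)[OF \<sigma>, of "q w"]
    by (simp add: \<psi>_def \<Omega>_def \<phi>_def norm_eq_1_iff_real4 vec_eq_iff forall_3) (simp add: q_def)
  show "\<nu> \<in> critical_surface \<longleftrightarrow> \<phi> \<nu> \<in> {w. (w$1)\<^sup>2 = w$2 * (w$3)\<^sup>2}" if "norm \<nu> = 1" for \<nu>
    unfolding critical_surface_iff[OF that] by (auto simp: \<phi>_def power_mult_distrib mult.commute)
qed

text \<open>Near a pole \<open>\<nu>\<^sub>3 = \<plusminus>1\<close> the chart \<open>(\<nu>\<^sub>2, \<nu>\<^sub>4, \<nu>\<^sub>1 s)\<close> serves twice: for the surface, and for its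
  self-intersection locus, which has to be described separately. Hence the set \<open>S\<close> is arbitrary.\<close>

lemma chart_at_poles:
  fixes \<sigma> :: real
  assumes \<sigma>: "\<sigma>\<^sup>2 = 1"
    and S: "\<And>\<nu>. norm \<nu> = 1 \<Longrightarrow> 2 * (\<nu>$2)\<^sup>2 < 1 \<Longrightarrow> \<sigma> * \<nu>$3 > 0 \<Longrightarrow>
      \<nu> \<in> S \<longleftrightarrow> vector [\<nu>$2, \<nu>$4, \<nu>$1 * sqrt (1 - 2 * (\<nu>$2)\<^sup>2)] \<in> M"
  shows "locally_given_by S (vector [0, 0, \<sigma>, 0]) M"
proof (rule locally_given_byI)
  let ?p = "vector [0, 0, \<sigma>, 0] :: real^4"
  define \<Omega> where "\<Omega> = {\<nu>::real^4. 2 * (\<nu>$2)\<^sup>2 < 1 \<and> \<sigma> * \<nu>$3 > 0}"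
  define s where "s = (\<lambda>x::real. sqrt (1 - 2 * x\<^sup>2))"
  define \<phi> :: "real^4 \<Rightarrow> real^3" where "\<phi> = (\<lambda>\<nu>. vector [\<nu>$2, \<nu>$4, \<nu>$1 * s (\<nu>$2)])"
  define q where "q = (\<lambda>w::real^3. 1 - (w$3 / s (w$1))\<^sup>2 - (w$1)\<^sup>2 - (w$2)\<^sup>2)"
  define \<psi> :: "real^3 \<Rightarrow> real^4"
    where "\<psi> = (\<lambda>w. vector [w$3 / s (w$1), w$1, \<sigma> * sqrt (q w), w$2])"
  \<comment> \<open>Again \<open>q w > 0\<close> without denominators.\<close>
  define V where "V = {w::real^3. 2 * (w$1)\<^sup>2 < 1
      \<and> (1 - 2 * (w$1)\<^sup>2) * (1 - (w$1)\<^sup>2 - (w$2)\<^sup>2) > (w$3)\<^sup>2}"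
  have "open \<Omega>" unfolding \<Omega>_def by (intro open_Collect_conj open_Collect_less continuous_intros)
  have "open V" unfolding V_def by (intro open_Collect_conj open_Collect_less continuous_intros)
  have s: "s x > 0" "s x \<noteq> 0" "(s x)\<^sup>2 = 1 - 2 * x\<^sup>2" if "2 * x\<^sup>2 < 1" for x
    using that by (auto simp: s_def)
  have V: "2 * (w$1)\<^sup>2 < 1" "q w > 0" if "w \<in> V" for w
  proof -
    show w: "2 * (w$1)\<^sup>2 < 1" using that by (simp add: V_def)
    then show "q w > 0"
      using that unfolding q_def V_def power_divide s(3)[OF w] by (simp add: field_simps)
  qed
  show "smooth_on \<Omega> \<phi>"
    unfolding \<phi>_def s_def using \<open>open \<Omega>\<close> by (intro smooth_on_intros) (auto simp: \<Omega>_def)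
  have ss: "smooth_on V (\<lambda>w. s (w$1))"
    unfolding s_def using \<open>open V\<close> V by (intro smooth_on_intros) auto
  have "smooth_on V q"
    unfolding q_def using \<open>open V\<close> ss V s by (intro smooth_on_intros) auto
  then show "smooth_on V \<psi>"
    unfolding \<psi>_def using \<open>open V\<close> ss V s by (intro smooth_on_intros) auto
  show "?p \<in> \<Omega>" "norm ?p = 1" "\<phi> ?p = 0"
    using \<sigma> by (auto simp: \<Omega>_def \<phi>_def norm_eq_1_iff_real4 vec_eq_iff forall_3 power2_eq_square)
  show "\<phi> \<nu> \<in> V \<and> \<psi> (\<phi> \<nu>) = \<nu>" if "\<nu> \<in> \<Omega>" "norm \<nu> = 1" for \<nu>
  proof -
    have pos: "2 * (\<nu>$2)\<^sup>2 < 1" "\<sigma> * \<nu>$3 > 0" using that by (auto simp: \<Omega>_def)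
    then have nz: "\<nu>$3 \<noteq> 0" by auto
    have c: "1 - (\<nu>$1)\<^sup>2 - (\<nu>$2)\<^sup>2 - (\<nu>$4)\<^sup>2 = (\<nu>$3)\<^sup>2"
      using that by (simp add: norm_eq_1_iff_real4)
    have qq: "q (\<phi> \<nu>) = (\<nu>$3)\<^sup>2"
      unfolding q_def c[symmetric] using s[OF pos(1)] by (simp add: \<phi>_def)
    have "(1 - 2 * (\<nu>$2)\<^sup>2) * (\<nu>$3)\<^sup>2 > 0" using nz pos by simp
    then have "\<phi> \<nu> \<in> V"
      using pos unfolding c[symmetric]
      by (simp add: V_def \<phi>_def algebra_simps power_mult_distrib s(3)[OF pos(1)])
    moreover have "\<psi> (\<phi> \<nu>) = \<nu>"
      unfolding \<psi>_def qq signed_sqrt(1)[OF \<sigma> pos(2)]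
      using s[OF pos(1)] by (simp add: vec_eq_iff forall_4 \<phi>_def)
    ultimately show ?thesis ..
  qed
  show "\<psi> w \<in> \<Omega> \<and> norm (\<psi> w) = 1 \<and> \<phi> (\<psi> w) = w" if "w \<in> V" for w
    using V[OF that] s[OF V(1)[OF that]] signed_sqrt(2,3)[OF \<sigma>, of "q w"]
    by (simp add: \<psi>_def \<Omega>_def \<phi>_def norm_eq_1_iff_real4 vec_eq_iff forall_3) (simp add: q_def)
  show "\<nu> \<in> S \<longleftrightarrow> \<phi> \<nu> \<in> M" if "\<nu> \<in> \<Omega>" "norm \<nu> = 1" for \<nu>
    using S[OF that(2)] that(1) by (simp add: \<Omega>_def \<phi>_def s_def)
qed

lemma saddle_at_poles:
  assumes "\<sigma>\<^sup>2 = 1"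
  shows "saddle_self_intersection critical_surface (vector [0, 0, \<sigma>, 0])"
  unfolding saddle_self_intersection_def
  by (rule chart_at_poles[OF assms]) (simp add: critical_surface_iff power_mult_distrib)

text \<open>The two factors \<open>\<nu>\<^sub>1 s \<plusminus> \<nu>\<^sub>2 \<nu>\<^sub>4\<close> determine \<open>\<nu>\<^sub>1\<close> and \<open>\<nu>\<^sub>4\<close> once \<open>\<nu>\<^sub>2 \<noteq> 0\<close> is known, and \<open>\<nu>\<^sub>2\<close> is the third
  coordinate, running along the line.\<close>

lemma transverse_on_1_4_zero:
  assumes p: "norm p = 1" "p$1 = 0" "p$4 = 0" "p$2 \<noteq> 0" "2 * (p$2)\<^sup>2 < 1"
  shows "transverse_self_intersection critical_surface p"
proof -
  have "(p$3)\<^sup>2 \<noteq> 0" using p norm_eq_1_iff_real4[of p] by auto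
  then have "p$3 \<noteq> 0" by simp
  from ex_sign[OF this] obtain \<sigma> where \<sigma>: "\<sigma>\<^sup>2 = 1" "\<sigma> * p$3 > 0" by blast
  from ex_sign[OF p(4)] obtain \<beta> where \<beta>: "\<beta>\<^sup>2 = 1" "\<beta> * p$2 > 0" by blast
  show ?thesis
    unfolding transverse_self_intersection_def
  proof (rule locally_given_byI)
    define \<Omega> where "\<Omega> = {\<nu>::real^4. 2 * (\<nu>$2)\<^sup>2 < 1 \<and> \<beta> * \<nu>$2 > 0 \<and> \<sigma> * \<nu>$3 > 0}"
    define s where "s = (\<lambda>x::real. sqrt (1 - 2 * x\<^sup>2))"
    define \<phi> :: "real^4 \<Rightarrow> real^3" where "\<phi> = (\<lambda>\<nu>. vector
        [\<nu>$1 * s (\<nu>$2) - \<nu>$2 * \<nu>$4, \<nu>$1 * s (\<nu>$2) + \<nu>$2 * \<nu>$4, \<nu>$2 - p$2])"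
    define b where "b = (\<lambda>w::real^3. w$3 + p$2)"
    define a where "a = (\<lambda>w. (w$1 + w$2) / (2 * s (b w)))"
    define d where "d = (\<lambda>w. (w$2 - w$1) / (2 * b w))"
    define q where "q = (\<lambda>w. 1 - (a w)\<^sup>2 - (b w)\<^sup>2 - (d w)\<^sup>2)"
    define \<psi> :: "real^3 \<Rightarrow> real^4" where "\<psi> = (\<lambda>w. vector [a w, b w, \<sigma> * sqrt (q w), d w])"
    define V0 where "V0 = {w. 2 * (b w)\<^sup>2 < 1 \<and> \<beta> * b w > 0}"
    define V where "V = {w \<in> V0. q w > 0}"
    have "open \<Omega>" unfolding \<Omega>_def by (intro open_Collect_conj open_Collect_less continuous_intros)
    have "open V0" unfolding V0_def b_def
      by (intro open_Collect_conj open_Collect_less continuous_intros)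
    have s: "s x > 0" "s x \<noteq> 0" "(s x)\<^sup>2 = 1 - 2 * x\<^sup>2" if "2 * x\<^sup>2 < 1" for x
      using that by (auto simp: s_def)
    have V0: "s (b w) \<noteq> 0" "b w \<noteq> 0" if "w \<in> V0" for w
      using that s(2) by (auto simp: V0_def)
    have "smooth_on V0 b"
      unfolding b_def using \<open>open V0\<close> by (intro smooth_on_intros)
    then have "smooth_on V0 (\<lambda>w. s (b w))"
      unfolding s_def using \<open>open V0\<close> by (intro smooth_on_intros) (auto simp: V0_def)
    then have "smooth_on V0 a"
      unfolding a_def using \<open>open V0\<close> V0 by (intro smooth_on_intros) auto
    moreover have "smooth_on V0 d"
      unfolding d_def using \<open>open V0\<close> \<open>smooth_on V0 b\<close> V0 by (intro smooth_on_intros) auto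
    moreover note \<open>smooth_on V0 b\<close>
    ultimately have sm: "smooth_on V0 a" "smooth_on V0 b" "smooth_on V0 d" by blast+
    then have sq: "smooth_on V0 q"
      unfolding q_def using \<open>open V0\<close> by (intro smooth_on_intros)
    have "continuous_on V0 q" using sq by (metis Ck_on.simps(1) smooth_on_def)
    have "open V"
      using continuous_open_preimage[OF \<open>continuous_on V0 q\<close> \<open>open V0\<close> open_greaterThan[of 0]]
      by (simp add: V_def vimage_def Int_def)
    have smV: "smooth_on V f" if "smooth_on V0 f" for f :: "real^3 \<Rightarrow> real"
      using smooth_on_subset[OF that \<open>open V\<close>] by (auto simp: V_def)
    show "smooth_on \<Omega> \<phi>"
      unfolding \<phi>_def s_def using \<open>open \<Omega>\<close> by (intro smooth_on_intros) (auto simp: \<Omega>_def)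
    show "smooth_on V \<psi>"
      unfolding \<psi>_def using \<open>open V\<close> sm sq smV by (intro smooth_on_intros) (auto simp: V_def)
    show "p \<in> \<Omega>" "norm p = 1" "\<phi> p = 0"
      using p \<sigma> \<beta> by (auto simp: \<Omega>_def \<phi>_def vec_eq_iff forall_3)
    show "\<phi> \<nu> \<in> V \<and> \<psi> (\<phi> \<nu>) = \<nu>" if "\<nu> \<in> \<Omega>" "norm \<nu> = 1" for \<nu>
    proof -
      have pos: "2 * (\<nu>$2)\<^sup>2 < 1" "\<beta> * \<nu>$2 > 0" "\<sigma> * \<nu>$3 > 0" using that by (auto simp: \<Omega>_def)
      then have nz: "\<nu>$2 \<noteq> 0" "\<nu>$3 \<noteq> 0" by auto
      have b: "b (\<phi> \<nu>) = \<nu>$2" by (simp add: b_def \<phi>_def)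
      have a: "a (\<phi> \<nu>) = \<nu>$1" using s[OF pos(1)] unfolding a_def b by (simp add: \<phi>_def)
      have d: "d (\<phi> \<nu>) = \<nu>$4" using nz unfolding d_def b by (simp add: \<phi>_def)
      have q: "q (\<phi> \<nu>) = (\<nu>$3)\<^sup>2"
        using that unfolding q_def a b d by (simp add: norm_eq_1_iff_real4)
      have "\<phi> \<nu> \<in> V" using pos nz by (simp add: V_def V0_def b q)
      moreover have "\<psi> (\<phi> \<nu>) = \<nu>"
        unfolding \<psi>_def a b d q signed_sqrt(1)[OF \<sigma>(1) pos(3)] by (simp add: vec_eq_iff forall_4)
      ultimately show ?thesis ..
    qed
    show "\<psi> w \<in> \<Omega> \<and> norm (\<psi> w) = 1 \<and> \<phi> (\<psi> w) = w" if "w \<in> V" for w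
    proof -
      have w: "2 * (b w)\<^sup>2 < 1" "\<beta> * b w > 0" "q w > 0" using that by (auto simp: V_def V0_def)
      then have "\<psi> w \<in> \<Omega>" using signed_sqrt(3)[OF \<sigma>(1)] by (simp add: \<Omega>_def \<psi>_def)
      moreover have "norm (\<psi> w) = 1"
        using w signed_sqrt(2)[OF \<sigma>(1)] by (simp add: \<psi>_def norm_eq_1_iff_real4) (simp add: q_def)
      moreover have "a w * s (b w) = (w$1 + w$2) / 2" "b w * d w = (w$2 - w$1) / 2"
        using w s(2)[OF w(1)] by (auto simp: a_def d_def)
      then have "\<phi> (\<psi> w) = w"
        by (simp add: \<phi>_def \<psi>_def vec_eq_iff forall_3 field_simps) (simp add: b_def)
      ultimately show ?thesis by blast
    qed
    show "\<nu> \<in> critical_surface \<longleftrightarrow> \<phi> \<nu> \<in> {w. w$1 * w$2 = 0}"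
      if "\<nu> \<in> \<Omega>" "norm \<nu> = 1" for \<nu>
    proof -
      have 1: "2 * (\<nu>$2)\<^sup>2 < 1" using that by (simp add: \<Omega>_def)
      have "\<phi> \<nu> $ 1 * \<phi> \<nu> $ 2 = (\<nu>$1)\<^sup>2 * (s (\<nu>$2))\<^sup>2 - (\<nu>$2)\<^sup>2 * (\<nu>$4)\<^sup>2"
        by (simp add: \<phi>_def algebra_simps power2_eq_square)
      then show ?thesis
        unfolding critical_surface_iff[OF that(2)] mem_Collect_eq s(3)[OF 1]
        by (simp del: mult_eq_0_iff)
    qed
  qed
qed

text \<open>Using the factors \<open>\<nu>\<^sub>1 s \<plusminus> \<nu>\<^sub>2 \<nu>\<^sub>4\<close> as coordinates here would need an implicit function for the
  inverse. Dividing by \<open>\<nu>\<^sub>4\<close>, and taking the slope \<open>\<nu>\<^sub>3 / \<nu>\<^sub>4\<close> as third coordinate, avoids this: \<open>\<nu>\<^sub>2\<close>,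
  \<open>\<nu>\<^sub>1 / \<nu>\<^sub>4\<close> and \<open>\<nu>\<^sub>3 / \<nu>\<^sub>4\<close> are then known functions, and the equation of the sphere yields
  \<open>\<nu>\<^sub>4\<^sup>2 = (1 - \<nu>\<^sub>2\<^sup>2) / ((\<nu>\<^sub>1 / \<nu>\<^sub>4)\<^sup>2 + (\<nu>\<^sub>3 / \<nu>\<^sub>4)\<^sup>2 + 1)\<close>.\<close>

lemma transverse_on_1_2_zero:
  assumes p: "norm p = 1" "p$1 = 0" "p$2 = 0" "p$4 \<noteq> 0"
  shows "transverse_self_intersection critical_surface p"
proof -
  from ex_sign[OF p(4)] obtain \<sigma> where \<sigma>: "\<sigma>\<^sup>2 = 1" "\<sigma> * p$4 > 0" by blast
  show ?thesis
    unfolding transverse_self_intersection_def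
  proof (rule locally_given_byI)
    define \<Omega> where "\<Omega> = {\<nu>::real^4. 2 * (\<nu>$2)\<^sup>2 < 1 \<and> \<sigma> * \<nu>$4 > 0}"
    define s where "s = (\<lambda>x::real. sqrt (1 - 2 * x\<^sup>2))"
    define \<phi> :: "real^4 \<Rightarrow> real^3" where "\<phi> = (\<lambda>\<nu>. vector
        [\<nu>$1 * s (\<nu>$2) / \<nu>$4 - \<nu>$2, \<nu>$1 * s (\<nu>$2) / \<nu>$4 + \<nu>$2, \<nu>$3 / \<nu>$4 - p$3 / p$4])"
    define u where "u = (\<lambda>w::real^3. (w$1 + w$2) / 2)"
    define b where "b = (\<lambda>w::real^3. (w$2 - w$1) / 2)"
    define t where "t = (\<lambda>w::real^3. w$3 + p$3 / p$4)"
    define q where "q = (\<lambda>w. (1 - (b w)\<^sup>2) / ((u w / s (b w))\<^sup>2 + (t w)\<^sup>2 + 1))"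
    define d where "d = (\<lambda>w. \<sigma> * sqrt (q w))"
    define \<psi> :: "real^3 \<Rightarrow> real^4"
      where "\<psi> = (\<lambda>w. vector [u w / s (b w) * d w, b w, t w * d w, d w])"
    define V where "V = {w. 2 * (b w)\<^sup>2 < 1}"
    have den: "x\<^sup>2 + y\<^sup>2 + 1 > 0" for x y :: real
      by (intro add_nonneg_pos add_nonneg_nonneg) auto
    have "open \<Omega>" unfolding \<Omega>_def by (intro open_Collect_conj open_Collect_less continuous_intros)
    have "open V" unfolding V_def b_def by (intro open_Collect_less continuous_intros) auto
    have s: "s x > 0" "s x \<noteq> 0" "(s x)\<^sup>2 = 1 - 2 * x\<^sup>2" if "2 * x\<^sup>2 < 1" for x
      using that by (auto simp: s_def)
    have V: "s (b w) \<noteq> 0" "q w > 0" if "w \<in> V" for w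
      using that s(2)[of "b w"] den by (auto simp: V_def q_def)
    have sm: "smooth_on V b" "smooth_on V u" "smooth_on V t"
      unfolding b_def u_def t_def using \<open>open V\<close> by (intro smooth_on_intros; simp)+
    have ss: "smooth_on V (\<lambda>w. s (b w))"
      unfolding s_def using \<open>open V\<close> sm by (intro smooth_on_intros) (auto simp: V_def)
    have "smooth_on V q"
      unfolding q_def
      by (intro smooth_on_intros sm ss V(1) \<open>open V\<close> den[THEN less_imp_neq, THEN not_sym])
    then have "smooth_on V d"
      unfolding d_def using \<open>open V\<close> V by (intro smooth_on_intros) auto
    then show "smooth_on V \<psi>"
      unfolding \<psi>_def using \<open>open V\<close> sm ss V by (intro smooth_on_intros) auto
    show "smooth_on \<Omega> \<phi>"
      unfolding \<phi>_def s_def using \<open>open \<Omega>\<close> by (intro smooth_on_intros) (auto simp: \<Omega>_def)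
    show "p \<in> \<Omega>" "norm p = 1" "\<phi> p = 0"
      using p \<sigma> by (auto simp: \<Omega>_def \<phi>_def vec_eq_iff forall_3)
    show "\<phi> \<nu> \<in> V \<and> \<psi> (\<phi> \<nu>) = \<nu>" if "\<nu> \<in> \<Omega>" "norm \<nu> = 1" for \<nu>
    proof -
      have pos: "2 * (\<nu>$2)\<^sup>2 < 1" "\<sigma> * \<nu>$4 > 0" using that by (auto simp: \<Omega>_def)
      then have nz: "\<nu>$4 \<noteq> 0" by auto
      have b: "b (\<phi> \<nu>) = \<nu>$2" by (simp add: b_def \<phi>_def)
      have u: "u (\<phi> \<nu>) / s (\<nu>$2) = \<nu>$1 / \<nu>$4"
        using s[OF pos(1)] by (simp add: u_def \<phi>_def)
      have t: "t (\<phi> \<nu>) = \<nu>$3 / \<nu>$4" by (simp add: t_def \<phi>_def)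
      have "1 - (\<nu>$2)\<^sup>2 = (\<nu>$4)\<^sup>2 * ((\<nu>$1 / \<nu>$4)\<^sup>2 + (\<nu>$3 / \<nu>$4)\<^sup>2 + 1)"
        using that nz by (simp add: norm_eq_1_iff_real4 power_divide distrib_left)
      then have q: "q (\<phi> \<nu>) = (\<nu>$4)\<^sup>2"
        unfolding q_def b u t using den[of "\<nu>$1 / \<nu>$4" "\<nu>$3 / \<nu>$4"] by simp
      have d: "d (\<phi> \<nu>) = \<nu>$4"
        unfolding d_def q by (rule signed_sqrt(1)[OF \<sigma>(1) pos(2)])
      have "\<phi> \<nu> \<in> V" using pos by (simp add: V_def b)
      moreover have "\<psi> (\<phi> \<nu>) = \<nu>"
        unfolding \<psi>_def b u t d using nz by (simp add: vec_eq_iff forall_4)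
      ultimately show ?thesis ..
    qed
    show "\<psi> w \<in> \<Omega> \<and> norm (\<psi> w) = 1 \<and> \<phi> (\<psi> w) = w" if "w \<in> V" for w
    proof -
      have w: "2 * (b w)\<^sup>2 < 1" "q w > 0" using that V by (auto simp: V_def)
      have d: "\<sigma> * d w > 0" "d w \<noteq> 0" "(d w)\<^sup>2 = q w"
        using signed_sqrt(2,3)[OF \<sigma>(1), of "q w"] w by (auto simp: d_def)
      then have "\<psi> w \<in> \<Omega>" using w by (simp add: \<Omega>_def \<psi>_def)
      moreover have "(d w)\<^sup>2 * ((u w / s (b w))\<^sup>2 + (t w)\<^sup>2 + 1) = 1 - (b w)\<^sup>2"
        unfolding d(3) q_def using den[of "u w / s (b w)" "t w"] by simp
      then have "norm (\<psi> w) = 1"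
        by (simp add: \<psi>_def norm_eq_1_iff_real4 power_mult_distrib power_divide algebra_simps)
      moreover have "\<phi> (\<psi> w) = w"
        using d(2) s(2)[OF w(1)]
        by (simp add: \<phi>_def \<psi>_def vec_eq_iff forall_3) (simp add: b_def u_def t_def field_simps)
      ultimately show ?thesis by blast
    qed
    show "\<nu> \<in> critical_surface \<longleftrightarrow> \<phi> \<nu> \<in> {w. w$1 * w$2 = 0}"
      if "\<nu> \<in> \<Omega>" "norm \<nu> = 1" for \<nu>
    proof -
      have 1: "2 * (\<nu>$2)\<^sup>2 < 1" "\<nu>$4 \<noteq> 0" using that by (auto simp: \<Omega>_def)
      have "\<phi> \<nu> $ 1 * \<phi> \<nu> $ 2 = (\<nu>$1)\<^sup>2 * (s (\<nu>$2))\<^sup>2 / (\<nu>$4)\<^sup>2 - (\<nu>$2)\<^sup>2"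
        by (simp add: \<phi>_def algebra_simps power2_eq_square)
      then show ?thesis
        unfolding critical_surface_iff[OF that(2)] mem_Collect_eq using 1
        by (simp add: s(3)[OF 1(1)] divide_eq_eq del: mult_eq_0_iff)
    qed
  qed
qed

section \<open>An obstruction to transversality\<close>

lemma transverse_imp_mem:
  assumes "transverse_self_intersection S p"
  shows "p \<in> S" "norm p = 1"
proof -
  obtain U and \<phi> :: "real^4 \<Rightarrow> real^3" where U: "openin (top_of_set (sphere 0 1)) U" "p \<in> U" "\<phi> p = 0"
    and S: "\<forall>\<nu>\<in>U. \<nu> \<in> S \<longleftrightarrow> \<phi> \<nu> $ 1 * \<phi> \<nu> $ 2 = 0"
    using assms
    unfolding transverse_self_intersection_def locally_given_by_def local_coordinates_at_def by auto
  show "p \<in> S" using S U by simp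
  show "norm p = 1" using openin_imp_subset[OF U(1)] U(2) by auto
qed

text \<open>The hypothesis says that near \<open>p\<close> the set \<open>S\<close> stays within \<open>o(norm (\<nu> - p))\<close> of the hyperplane through \<open>p\<close>
  orthogonal to \<open>l\<close>. If \<open>S\<close> were \<open>xy = 0\<close> in coordinates with inverse \<open>\<psi>\<close>, then the images of the three
  coordinate axes would be curves in \<open>S\<close>, so the derivative \<open>D\<close> of \<open>\<psi>\<close> at 0 would map into the orthogonal
  complement of \<open>l\<close>; it also maps into that of \<open>p\<close>, as \<open>\<psi>\<close> takes values in the sphere. But \<open>D\<close> is
  injective, and its rank 3 exceeds the dimension 2 of the orthogonal complement of \<open>l\<close> and \<open>p\<close>.\<close>

lemma not_transverse_if_flat:
  assumes flat: "\<And>e. e > 0 \<Longrightarrow>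
      \<forall>\<^sub>F \<nu> in nhds p. norm \<nu> = 1 \<longrightarrow> \<nu> \<in> S \<longrightarrow> \<bar>l \<bullet> (\<nu> - p)\<bar> \<le> e * norm (\<nu> - p)"
    and l: "l \<notin> span {p}"
  shows "\<not> transverse_self_intersection S p"
proof
  assume "transverse_self_intersection S p"
  then obtain U V and \<phi> :: "real^4 \<Rightarrow> real^3" and \<psi> where op: "openin (top_of_set (sphere 0 1)) U" "open V"
    and p: "p \<in> U" "\<phi> p = 0"
    and hom: "homeomorphism U V \<phi> \<psi>" and sm: "smooth_map_on U \<phi>" "smooth_map_on V \<psi>"
    and S: "\<And>\<nu>. \<nu> \<in> U \<Longrightarrow> \<nu> \<in> S \<longleftrightarrow> \<phi> \<nu> $ 1 * \<phi> \<nu> $ 2 = 0"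
    unfolding transverse_self_intersection_def locally_given_by_def local_coordinates_at_def
      diffeomorphism_def by auto
  have U: "U \<subseteq> sphere 0 1" using op(1) openin_imp_subset by blast
  have 0: "0 \<in> V" "\<psi> 0 = p"
    using hom p by (force simp: homeomorphism_def)+
  have diff: "\<exists>W g D. open W \<and> a \<in> W \<and> (g has_derivative D) (at a) \<and> (\<forall>y\<in>X \<inter> W. f y = g y)"
    if "smooth_map_on X f" "a \<in> X"
    for X and f :: "'u::euclidean_space \<Rightarrow> 'v::euclidean_space" and a
  proof -
    obtain W g where W: "open W" "a \<in> W" "\<forall>k. Ck_on k W g" "\<forall>y\<in>X \<inter> W. f y = g y"
      using \<open>smooth_map_on X f\<close> \<open>a \<in> X\<close> unfolding smooth_map_on_def by metis
    then have "Ck_on (Suc 0) W g" by blast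
    then have "g differentiable (at a)" using W(2) by simp
    then show ?thesis using W by (auto simp: differentiable_def)
  qed
  obtain W g D where W: "open W" "0 \<in> W" "(g has_derivative D) (at 0)" "\<And>y. y \<in> V \<inter> W \<Longrightarrow> \<psi> y = g y"
    using diff[OF sm(2) 0(1)] by blast
  have D: "(\<psi> has_derivative D) (at 0)"
    by (rule has_derivative_transform_within_open[OF W(3), of "V \<inter> W"]) (use op W 0 in auto)
  obtain W' f E where W': "open W'" "p \<in> W'" "(f has_derivative E) (at p)" "\<And>y. y \<in> U \<inter> W' \<Longrightarrow> \<phi> y = f y"
    using diff[OF sm(1) p(1)] by blast
  have V: "\<psi> w \<in> U" "\<phi> (\<psi> w) = w" "norm (\<psi> w) = 1" if "w \<in> V" for w
    using hom that U by (auto simp: homeomorphism_def)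
  have near: "\<forall>\<^sub>F w in nhds 0. w \<in> V"
    using op(2) 0(1) by (rule eventually_nhds_in_open)
  have tend: "filterlim \<psi> (nhds p) (nhds 0)"
    using has_derivative_continuous[OF D] unfolding 0(2)[symmetric]
    by (simp only: continuous_at tendsto_at_iff_tendsto_nhds)
  have near': "\<forall>\<^sub>F w in nhds 0. \<psi> w \<in> W'"
    using eventually_nhds_in_open[OF W'(1,2)] tend by (auto simp: filterlim_iff)
  \<comment> \<open>The chain rule for \<open>\<phi> (\<psi> w) = w\<close> gives \<open>D\<close> a left inverse.\<close>
  have "((\<lambda>w. f (\<psi> w)) has_derivative (\<lambda>v. E (D v))) (at 0)"
    using has_derivative_compose[OF D] W'(3) 0(2) by simp
  moreover have "\<forall>\<^sub>F w in nhds 0. f (\<psi> w) = w"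
    using near near' by eventually_elim (use V W'(4) in force)
  then have "\<forall>\<^sub>F w in at 0. f (\<psi> w) = w" "f (\<psi> 0) = 0"
    by (auto simp: eventually_at_filter elim: eventually_mono dest: eventually_nhds_x_imp_x)
  ultimately have "((\<lambda>w. w) has_derivative (\<lambda>v. E (D v))) (at 0)"
    using has_derivative_transform_eventually[of "\<lambda>w. f (\<psi> w)" _ 0 UNIV "\<lambda>w. w"] by simp
  then have ED: "E (D v) = v" for v
    using has_derivative_unique[OF _ has_derivative_ident] by metis
  then have "inj D" by (metis injI)
  have "linear D" using D has_derivative_linear by blast
  \<comment> \<open>Differentiating \<open>\<psi> w \<bullet> \<psi> w = 1\<close>.\<close>
  have pD: "p \<bullet> D v = 0" for v
  proof -
    have "((\<lambda>w. \<psi> w \<bullet> \<psi> w) has_derivative (\<lambda>v. p \<bullet> D v + D v \<bullet> p)) (at 0)"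
      using has_derivative_inner[OF D D] 0(2) by simp
    moreover have "((\<lambda>w. \<psi> w \<bullet> \<psi> w) has_derivative (\<lambda>v. 0)) (at 0)"
      by (rule has_derivative_transform_within_open[OF has_derivative_const[of 1] op(2) 0(1)])
        (use V(3) in \<open>auto simp: norm_eq_1\<close>)
    ultimately have "(\<lambda>v. p \<bullet> D v + D v \<bullet> p) = (\<lambda>v. 0)"
      by (rule has_derivative_unique)
    then show ?thesis by (metis inner_commute mult_2 mult_eq_0_iff zero_neq_numeral)
  qed
  \<comment> \<open>Along an axis, compare the difference quotient of \<open>\<psi>\<close> with the flatness bound for arbitrary \<open>e\<close>.\<close>
  have lD: "l \<bullet> D (axis i 1) = 0" for i
  proof -
    let ?e = "axis i 1 :: real^3"
    let ?c = "\<lambda>t. (\<psi> (t *\<^sub>R ?e) - p) /\<^sub>R t"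
    have ray: "((\<lambda>t::real. t *\<^sub>R ?e) \<longlongrightarrow> 0) (nhds 0)"
      using tendsto_scaleR[OF filterlim_ident[of "nhds (0::real)"] tendsto_const[of ?e]] by simp
    have "((\<lambda>t::real. \<psi> (t *\<^sub>R ?e)) has_derivative (\<lambda>t. D (t *\<^sub>R ?e))) (at 0)"
      by (rule has_derivative_compose[of "\<lambda>t. t *\<^sub>R ?e"]) (use D in \<open>auto intro!: derivative_eq_intros\<close>)
    then have small: "((\<lambda>t. norm (\<psi> (t *\<^sub>R ?e) - p - t *\<^sub>R D ?e) / \<bar>t\<bar>) \<longlongrightarrow> 0) (at 0)"
      unfolding has_derivative_at by (simp add: 0(2) linear_scale[OF \<open>linear D\<close>])
    have quotient: "norm (\<psi> (t *\<^sub>R ?e) - p - t *\<^sub>R D ?e) / \<bar>t\<bar> = norm (?c t - D ?e)" if "t \<noteq> 0" for t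
    proof -
      have "?c t - D ?e = (\<psi> (t *\<^sub>R ?e) - p - t *\<^sub>R D ?e) /\<^sub>R t"
        using that by (simp add: scaleR_diff_right)
      then show ?thesis by (simp add: divide_inverse mult.commute)
    qed
    have "((\<lambda>t. norm (?c t - D ?e)) \<longlongrightarrow> 0) (at 0)"
      using small by (rule Lim_transform_eventually) (simp add: eventually_at_filter quotient)
    then have lim: "(?c \<longlongrightarrow> D ?e) (at 0)"
      by (simp add: tendsto_norm_zero_iff LIM_zero_iff)
    have le: "\<bar>l \<bullet> D ?e\<bar> \<le> e * norm (D ?e)" if "e > 0" for e
    proof (rule tendsto_le)
      show "((\<lambda>t. e * norm (?c t)) \<longlongrightarrow> e * norm (D ?e)) (at 0)"
        "((\<lambda>t. \<bar>l \<bullet> ?c t\<bar>) \<longlongrightarrow> \<bar>l \<bullet> D ?e\<bar>) (at 0)"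
        using lim by (intro tendsto_intros; simp)+
      have "\<forall>\<^sub>F w in nhds 0. norm (\<psi> w) = 1 \<longrightarrow> \<psi> w \<in> S \<longrightarrow>
          \<bar>l \<bullet> (\<psi> w - p)\<bar> \<le> e * norm (\<psi> w - p)"
        using flat[OF that] tend by (auto simp: filterlim_iff)
      with near have "\<forall>\<^sub>F w in nhds 0. w$1 * w$2 = 0 \<longrightarrow> \<bar>l \<bullet> (\<psi> w - p)\<bar> \<le> e * norm (\<psi> w - p)"
        by eventually_elim (use V S in auto)
      from eventually_compose_filterlim[OF this ray]
      have "\<forall>\<^sub>F t in nhds 0. \<bar>l \<bullet> (\<psi> (t *\<^sub>R ?e) - p)\<bar> \<le> e * norm (\<psi> (t *\<^sub>R ?e) - p)"
        by (rule eventually_mono) (auto simp: axis_def split: if_splits)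
      then have "\<forall>\<^sub>F t in at 0. \<bar>l \<bullet> (\<psi> (t *\<^sub>R ?e) - p)\<bar> \<le> e * norm (\<psi> (t *\<^sub>R ?e) - p)"
        unfolding eventually_at_filter by (rule eventually_mono) simp
      then show "\<forall>\<^sub>F t in at 0. \<bar>l \<bullet> ?c t\<bar> \<le> e * norm (?c t)"
        by eventually_elim (auto simp: abs_mult divide_simps)
    qed simp
    have "\<bar>l \<bullet> D ?e\<bar> \<le> (e / (norm (D ?e) + 1)) * norm (D ?e)" if "e > 0" for e
      by (rule le) (use that in \<open>simp add: add_nonneg_pos\<close>)
    moreover have "(e / (norm (D ?e) + 1)) * norm (D ?e) \<le> 0 + e" if "e > 0" for e
      using that by (simp add: pos_divide_le_eq add_nonneg_pos distrib_left)
    ultimately have "\<bar>l \<bullet> D ?e\<bar> \<le> 0"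
      by (meson field_le_epsilon order_trans)
    then show ?thesis by simp
  qed
  have lD': "l \<bullet> D v = 0" for v
  proof -
    have "v = (\<Sum>i\<in>UNIV. v$i *\<^sub>R axis i 1)"
      by (simp add: vec_eq_iff axis_def if_distrib cong: if_cong)
    then have "D v = (\<Sum>i\<in>UNIV. v$i *\<^sub>R D (axis i 1))"
      by (metis (no_types, lifting) linear_scale[OF \<open>linear D\<close>] linear_sum[OF \<open>linear D\<close>] sum.cong)
    then show ?thesis by (simp add: inner_sum_right lD)
  qed
  have "norm p = 1" using p(1) U by auto
  then have "independent {l, p}" "l \<noteq> p"
    using l span_base[of p "{p}"] by (auto simp: independent_insert dependent_single)
  then have 2: "dim (span {l, p}) = 2"
    by (simp add: dim_eq_card_independent)
  have "range D \<subseteq> {y \<in> UNIV. \<forall>x\<in>span {l, p}. orthogonal x y}"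
  proof safe
    fix v x assume "x \<in> span {l, p}"
    then show "orthogonal x (D v)"
      by (induction rule: span_induct_alt) (auto simp: orthogonal_def inner_left_distrib pD lD')
  qed auto
  then have "dim (range D) \<le> dim {y \<in> UNIV. \<forall>x\<in>span {l, p}. orthogonal x y}"
    by (rule dim_subset)
  moreover have "dim (range D) = 3"
    using dim_image_eq[OF \<open>linear D\<close>, of UNIV] \<open>inj D\<close> by (simp add: dim_UNIV)
  moreover have "dim {y \<in> UNIV. \<forall>x\<in>span {l, p}. orthogonal x y} + dim (span {l, p}) = dim (UNIV :: (real^4) set)"
    by (rule dim_subspace_orthogonal_to_vectors) auto
  ultimately show False using 2 by (simp add: dim_UNIV)
qed

section \<open>Points that are not transverse self-intersections\<close>

lemma not_in_span_single:
  fixes l p :: "real^4"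
  assumes "l $ i \<noteq> 0" "l $ j = 0" "p $ j \<noteq> 0"
  shows "l \<notin> span {p}"
proof
  assume "l \<in> span {p}"
  then obtain c where "l = c *\<^sub>R p" by (auto simp: span_singleton)
  then show False using assms by auto
qed

lemma abs_nth_diff_le: "\<bar>\<nu>$i - p$i\<bar> \<le> norm (\<nu> - p)" for \<nu> p :: "real^'n"
  using component_le_norm_cart[of "\<nu> - p" i] by simp

text \<open>Here \<open>\<nu>\<^sub>4\<^sup>2 = \<nu>\<^sub>1\<^sup>2 (1 - 2 \<nu>\<^sub>2\<^sup>2) / \<nu>\<^sub>2\<^sup>2\<close> on the surface, and the factor after \<open>\<nu>\<^sub>1\<^sup>2\<close> tends to 0 at \<open>p\<close>, so
  \<open>\<nu>\<^sub>4\<close> is of smaller order than \<open>\<nu>\<^sub>1\<close>.\<close>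

lemma not_transverse_pinch:
  assumes p: "p$1 = 0" "p$4 = 0" "2 * (p$2)\<^sup>2 = 1"
  shows "\<not> transverse_self_intersection critical_surface p"
proof (rule not_transverse_if_flat[where l = "axis 4 1"])
  fix e :: real assume e: "e > 0"
  have lim: "((\<lambda>\<nu>. \<bar>1 - 2 * (\<nu>$2)\<^sup>2\<bar>) \<longlongrightarrow> \<bar>1 - 2 * (p$2)\<^sup>2\<bar>) (nhds p)"
    "((\<lambda>\<nu>. (\<nu>$2)\<^sup>2) \<longlongrightarrow> (p$2)\<^sup>2) (nhds p)"
    by (intro tendsto_intros filterlim_ident)+
  have "\<forall>\<^sub>F \<nu> in nhds p. \<bar>1 - 2 * (\<nu>$2)\<^sup>2\<bar> < e\<^sup>2 / 4" "\<forall>\<^sub>F \<nu> in nhds p. 1 / 4 < (\<nu>$2)\<^sup>2"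
    using e p(3) by (intro order_tendstoD(2)[OF lim(1)] order_tendstoD(1)[OF lim(2)]; simp)+
  then show "\<forall>\<^sub>F \<nu> in nhds p. norm \<nu> = 1 \<longrightarrow> \<nu> \<in> critical_surface \<longrightarrow>
      \<bar>axis 4 1 \<bullet> (\<nu> - p)\<bar> \<le> e * norm (\<nu> - p)"
  proof (eventually_elim, intro impI)
    fix \<nu> :: "real^4"
    assume \<nu>: "\<bar>1 - 2 * (\<nu>$2)\<^sup>2\<bar> < e\<^sup>2 / 4" "1 / 4 < (\<nu>$2)\<^sup>2" "norm \<nu> = 1" "\<nu> \<in> critical_surface"
    have "1 / 4 * (\<nu>$4)\<^sup>2 \<le> (\<nu>$2)\<^sup>2 * (\<nu>$4)\<^sup>2"
      using \<nu>(2) by (intro mult_right_mono) auto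
    also have "\<dots> = (\<nu>$1)\<^sup>2 * (1 - 2 * (\<nu>$2)\<^sup>2)"
      using \<nu> critical_surface_iff by metis
    also have "\<dots> \<le> (\<nu>$1)\<^sup>2 * (e\<^sup>2 / 4)"
      using \<nu>(1) by (intro mult_left_mono) (linarith, simp)
    finally have "\<bar>\<nu>$4\<bar>\<^sup>2 \<le> (e * \<bar>\<nu>$1\<bar>)\<^sup>2" by (simp add: power_mult_distrib mult.commute)
    then have "\<bar>\<nu>$4\<bar> \<le> e * \<bar>\<nu>$1\<bar>" using e by (intro power2_le_imp_le[of "\<bar>\<nu>$4\<bar>"]) auto
    also have "\<dots> \<le> e * norm (\<nu> - p)"
      using e p abs_nth_diff_le[of \<nu> 1 p] by (intro mult_left_mono) auto
    finally show "\<bar>axis 4 1 \<bullet> (\<nu> - p)\<bar> \<le> e * norm (\<nu> - p)"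
      using p by (simp add: inner_axis')
  qed
next
  show "axis 4 1 \<notin> span {p}"
    using p by (intro not_in_span_single[of _ 4 2]) (auto simp: axis_def)
qed

text \<open>Near a pole \<open>1 - 2 \<nu>\<^sub>2\<^sup>2 \<ge> 1/2\<close>, so on the surface \<open>\<nu>\<^sub>1\<^sup>2\<close> is at most \<open>2 \<nu>\<^sub>2\<^sup>2 \<nu>\<^sub>4\<^sup>2\<close> and \<open>\<nu>\<^sub>1\<close> is of second
  order: \<open>\<nu>\<^sub>1 = 0\<close> is the common tangent plane of the two saddle sheets.\<close>

lemma not_transverse_pole:
  assumes p: "p$1 = 0" "p$2 = 0" "p$4 = 0" "p$3 \<noteq> 0"
  shows "\<not> transverse_self_intersection critical_surface p"
proof (rule not_transverse_if_flat[where l = "axis 1 1"])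
  fix e :: real assume e: "e > 0"
  have lim: "((\<lambda>\<nu>. (\<nu>$2)\<^sup>2) \<longlongrightarrow> (p$2)\<^sup>2) (nhds p)"
    by (intro tendsto_intros filterlim_ident)
  have "\<forall>\<^sub>F \<nu> in nhds p. (\<nu>$2)\<^sup>2 < e\<^sup>2 / 2" "\<forall>\<^sub>F \<nu> in nhds p. (\<nu>$2)\<^sup>2 < 1 / 4"
    using e p(2) by (intro order_tendstoD(2)[OF lim]; simp)+
  then show "\<forall>\<^sub>F \<nu> in nhds p. norm \<nu> = 1 \<longrightarrow> \<nu> \<in> critical_surface \<longrightarrow>
      \<bar>axis 1 1 \<bullet> (\<nu> - p)\<bar> \<le> e * norm (\<nu> - p)"
  proof (eventually_elim, intro impI)
    fix \<nu> :: "real^4"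
    assume \<nu>: "(\<nu>$2)\<^sup>2 < e\<^sup>2 / 2" "(\<nu>$2)\<^sup>2 < 1 / 4" "norm \<nu> = 1" "\<nu> \<in> critical_surface"
    have "(\<nu>$1)\<^sup>2 * (1 / 2) \<le> (\<nu>$1)\<^sup>2 * (1 - 2 * (\<nu>$2)\<^sup>2)"
      using \<nu>(2) by (intro mult_left_mono) auto
    also have "\<dots> = (\<nu>$2)\<^sup>2 * (\<nu>$4)\<^sup>2"
      using \<nu> critical_surface_iff by metis
    also have "\<dots> \<le> e\<^sup>2 / 2 * (\<nu>$4)\<^sup>2"
      using \<nu>(1) by (intro mult_right_mono) auto
    finally have "\<bar>\<nu>$1\<bar>\<^sup>2 \<le> (e * \<bar>\<nu>$4\<bar>)\<^sup>2" by (simp add: power_mult_distrib)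
    then have "\<bar>\<nu>$1\<bar> \<le> e * \<bar>\<nu>$4\<bar>" using e by (intro power2_le_imp_le[of "\<bar>\<nu>$1\<bar>"]) auto
    also have "\<dots> \<le> e * norm (\<nu> - p)"
      using e p abs_nth_diff_le[of \<nu> 4 p] by (intro mult_left_mono) auto
    finally show "\<bar>axis 1 1 \<bullet> (\<nu> - p)\<bar> \<le> e * norm (\<nu> - p)"
      using p by (simp add: inner_axis')
  qed
next
  show "axis 1 1 \<notin> span {p}"
    using p by (intro not_in_span_single[of _ 1 3]) (auto simp: axis_def)
qed

text \<open>At these points the equation of the surface has a gradient \<open>l\<close> that is not normal to the sphere: its
  first component is nonzero and its third is zero, while \<open>p\<^sub>3 \<noteq> 0\<close>. Hence the surface is smooth there,
  and \<open>l\<close> serves as the functional in the flatness criterion.\<close>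

lemma not_transverse_regular:
  assumes p: "norm p = 1" "p \<in> critical_surface" "p$1 \<noteq> 0" "p$3 \<noteq> 0" "2 * (p$2)\<^sup>2 < 1"
  shows "\<not> transverse_self_intersection critical_surface p"
proof -
  define G where "G = (\<lambda>\<nu>::real^4. (\<nu>$1)\<^sup>2 * (1 - 2 * (\<nu>$2)\<^sup>2) - (\<nu>$2)\<^sup>2 * (\<nu>$4)\<^sup>2)"
  define l :: "real^4" where "l = vector [2 * p$1 * (1 - 2 * (p$2)\<^sup>2),
      - 4 * (p$1)\<^sup>2 * p$2 - 2 * p$2 * (p$4)\<^sup>2, 0, - 2 * (p$2)\<^sup>2 * p$4]"
  have G: "G \<nu> = 0" if "norm \<nu> = 1" "\<nu> \<in> critical_surface" for \<nu>
    using critical_surface_iff[OF that(1)] that(2) by (simp add: G_def)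
  have D: "(G has_derivative (\<lambda>v. l \<bullet> v)) (at p)"
    unfolding G_def l_def
    by (auto intro!: derivative_eq_intros bounded_linear_imp_has_derivative bounded_linear_vec_nth ext
        simp: inner_vec_def sum_4 algebra_simps power2_eq_square)
  show ?thesis
  proof (rule not_transverse_if_flat[where l = l])
    fix e :: real assume "e > 0"
    then obtain r where r: "r > 0"
      "\<And>\<nu>. norm (\<nu> - p) < r \<Longrightarrow> norm (G \<nu> - G p - l \<bullet> (\<nu> - p)) \<le> e * norm (\<nu> - p)"
      using D unfolding has_derivative_at_alt by metis
    have "\<forall>\<^sub>F \<nu> in nhds p. \<nu> \<in> ball p r"
      using r(1) by (intro eventually_nhds_in_open) auto
    then show "\<forall>\<^sub>F \<nu> in nhds p. norm \<nu> = 1 \<longrightarrow> \<nu> \<in> critical_surface \<longrightarrow> \<bar>l \<bullet> (\<nu> - p)\<bar> \<le> e * norm (\<nu> - p)"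
    proof eventually_elim
      case (elim \<nu>)
      then show ?case
        using r(2)[of \<nu>] G[of \<nu>] G[OF p(1,2)] by (auto simp: dist_norm norm_minus_commute)
    qed
  next
    show "l \<notin> span {p}"
      using p by (intro not_in_span_single[of _ 1 3]) (auto simp: l_def)
  qed
qed

section \<open>The self-intersection locus\<close>

text \<open>For \<open>0 < t < h\<close> these points are on the lines along \<open>\<nu>\<^sub>1 = \<nu>\<^sub>4 = 0\<close>. The two ends of this arc are a pole, at
  \<open>t = 0\<close>, and a pinch point, at \<open>t = h\<close>, so by continuity all six exceptional points lie in the locus.\<close>

lemma meridian_in_locus:
  assumes \<beta>: "\<beta>\<^sup>2 = 1" and \<sigma>: "\<sigma>\<^sup>2 = 1" and t: "0 \<le> t" "t \<le> h"
  shows "vector [0, \<beta> * t, \<sigma> * sqrt (1 - t\<^sup>2), 0] \<in> self_intersection_locus critical_surface"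
proof -
  let ?g = "\<lambda>t::real. vector [0, \<beta> * t, \<sigma> * sqrt (1 - t\<^sup>2), 0] :: real^4"
  have h: "h > 0" "h\<^sup>2 = 1/2" by (simp_all add: h_def power_divide)
  have eq: "?g t = (\<beta> * t) *\<^sub>R axis 2 1 + (\<sigma> * sqrt (1 - t\<^sup>2)) *\<^sub>R axis 3 1" for t
    by (simp add: vec_eq_iff forall_4 axis_def)
  have "?g ` closure {0<..<h} \<subseteq> self_intersection_locus critical_surface"
  proof (rule image_closure_subset)
    show "continuous_on (closure {0<..<h}) ?g"
      unfolding eq by (intro continuous_intros)
    show "closed (self_intersection_locus critical_surface)" by (simp add: self_intersection_locus_def)
    show "?g ` {0<..<h} \<subseteq> self_intersection_locus critical_surface"
    proof safe
      fix t assume "t \<in> {0<..<h}"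
      then have t: "0 < t" "t\<^sup>2 < 1/2"
        using h(2) power_strict_mono[of t h 2] by auto
      then have "transverse_self_intersection critical_surface (?g t)"
        using \<beta> \<sigma> by (intro transverse_on_1_4_zero) (auto simp: norm_eq_1_iff_real4 power_mult_distrib)
      then show "?g t \<in> self_intersection_locus critical_surface"
        unfolding self_intersection_locus_def by (intro closure_subset[THEN subsetD]) simp
    qed
  qed
  moreover have "t \<in> closure {0<..<h}" using t h by simp
  ultimately show ?thesis by blast
qed

text \<open>Near a pole the transverse self-intersections have \<open>\<nu>\<^sub>1 = 0\<close>, since other points of the surface are
  regular, and then \<open>\<nu>\<^sub>2 \<nu>\<^sub>4 = 0\<close> by the equation. This is a closed condition and passes to the
  closure. Conversely, points satisfying it are on one of the lines or are the pole itself.\<close>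

lemma curves_cross_at_poles:
  assumes \<sigma>: "\<sigma>\<^sup>2 = 1"
  shows "self_intersection_curves_cross_transversely critical_surface (vector [0, 0, \<sigma>, 0])"
  unfolding self_intersection_curves_cross_transversely_def
proof (rule chart_at_poles[OF \<sigma>])
  fix \<nu> :: "real^4"
  assume \<nu>: "norm \<nu> = 1" "2 * (\<nu>$2)\<^sup>2 < 1" "\<sigma> * \<nu>$3 > 0"
  define T where "T = {p. transverse_self_intersection critical_surface p}"
  define W where "W = {\<nu>::real^4. 2 * (\<nu>$2)\<^sup>2 < 1 \<and> \<sigma> * \<nu>$3 > 0}"
  define C where "C = {\<nu>::real^4. \<nu>$1 = 0 \<and> \<nu>$2 * \<nu>$4 = 0}"
  have "open W" unfolding W_def by (intro open_Collect_conj open_Collect_less continuous_intros)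
  have "closed C" unfolding C_def by (intro closed_Collect_conj closed_Collect_eq continuous_intros)
  have "W \<inter> T \<subseteq> C"
  proof
    fix p assume p: "p \<in> W \<inter> T"
    then have S: "p \<in> critical_surface" "norm p = 1" using transverse_imp_mem by (auto simp: T_def)
    have "p$3 \<noteq> 0" using p by (auto simp: W_def)
    then have "p$1 = 0"
      using not_transverse_regular[OF S(2,1)] p by (auto simp: T_def W_def)
    moreover from this have "p$2 * p$4 = 0"
      using critical_surface_iff[OF S(2)] S(1) by simp
    ultimately show "p \<in> C" by (simp add: C_def)
  qed
  then have "W \<inter> closure T \<subseteq> C"
    using open_Int_closure_subset[OF \<open>open W\<close>, of T] closure_minimal[OF _ \<open>closed C\<close>] by blast
  then have "\<nu> \<in> C" if "\<nu> \<in> self_intersection_locus critical_surface"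
    using that \<nu> by (auto simp: self_intersection_locus_def T_def W_def)
  moreover have "\<nu> \<in> self_intersection_locus critical_surface" if C: "\<nu> \<in> C"
  proof (cases "\<nu>$2 = 0 \<and> \<nu>$4 = 0")
    case True
    then have "(\<nu>$3)\<^sup>2 = 1" using \<nu>(1) C by (simp add: norm_eq_1_iff_real4 C_def)
    then have "\<nu>$3 = \<sigma>"
      using signed_sqrt(1)[OF \<sigma> \<nu>(3)] by simp
    then have "\<nu> = vector [0, 1 * 0, \<sigma> * sqrt (1 - 0\<^sup>2), 0]"
      using True C by (simp add: vec_eq_iff forall_4 C_def)
    then show ?thesis
      using meridian_in_locus[of 1 \<sigma> 0] \<sigma> by (simp add: h_def)
  next
    case False
    then have "transverse_self_intersection critical_surface \<nu>"
      using C \<nu> transverse_on_1_4_zero[of \<nu>] transverse_on_1_2_zero[of \<nu>] by (auto simp: C_def)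
    then show ?thesis
      unfolding self_intersection_locus_def by (intro closure_subset[THEN subsetD]) simp
  qed
  ultimately have "\<nu> \<in> self_intersection_locus critical_surface \<longleftrightarrow> \<nu> \<in> C" by blast
  moreover have "sqrt (1 - 2 * (\<nu>$2)\<^sup>2) \<noteq> 0" using \<nu>(2) by simp
  ultimately show "\<nu> \<in> self_intersection_locus critical_surface \<longleftrightarrow>
      (vector [\<nu>$2, \<nu>$4, \<nu>$1 * sqrt (1 - 2 * (\<nu>$2)\<^sup>2)] :: real^3)
        \<in> {w. (w$1 = 0 \<and> w$3 = 0) \<or> (w$2 = 0 \<and> w$3 = 0)}"
    by (auto simp: C_def)
qed

lemma umbrella_points:
  assumes "p \<in> {P1, P2, P3, P4}"
  obtains \<beta> \<sigma> where "\<beta>\<^sup>2 = 1" "\<sigma>\<^sup>2 = 1" "p = vector [0, \<beta> * h, \<sigma> * h, 0]"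
  using assms that[of 1 1] that[of "-1" 1] that[of 1 "-1"] that[of "-1" "-1"]
  by (auto simp: P1_def P2_def P3_def P4_def)

lemma pole_points:
  assumes "p \<in> {P5, P6}"
  obtains \<sigma> where "\<sigma>\<^sup>2 = 1" "p = vector [0, 0, \<sigma>, 0]"
  using assms that[of 1] that[of "-1"] by (auto simp: P5_def P6_def)

theorem theorem2p6:
  shows "(\<forall>p \<in> L1 \<union> L2 \<union> L3 \<union> L4 \<union> L5 \<union> L6. transverse_self_intersection critical_surface p)
    \<and> (\<forall>p \<in> {P1, P2, P3, P4, P5, P6}. nontransverse_self_intersection critical_surface p)
    \<and> (\<forall>p \<in> {P1, P2, P3, P4}. whitney_umbrella critical_surface p)
    \<and> (\<forall>p \<in> {P5, P6}. self_intersection_curves_cross_transversely critical_surface p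
          \<and> saddle_self_intersection critical_surface p)"
proof -
  have h: "h > 0" "h\<^sup>2 = 1/2"
    by (simp_all add: h_def power_divide)
  then have sh: "sqrt (1 - h\<^sup>2) = h"
    by (intro real_sqrt_unique) auto
  have lines: "transverse_self_intersection critical_surface p" if "p \<in> L1 \<union> L2 \<union> L3 \<union> L4 \<union> L5 \<union> L6" for p
  proof (cases "p \<in> L5 \<union> L6")
    case True
    then show ?thesis
      by (intro transverse_on_1_2_zero) (auto simp: L5_def L6_def)
  next
    case False
    with that have p: "norm p = 1" "p$1 = 0" "p$4 = 0" "p$2 \<noteq> 0" "\<bar>p$2\<bar> < h"
      using h by (auto simp: L1_def L2_def L3_def L4_def)
    then have "(p$2)\<^sup>2 < h\<^sup>2" using power_strict_mono[of "\<bar>p$2\<bar>" h 2] by simp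
    then show ?thesis using p h by (intro transverse_on_1_4_zero) auto
  qed
  have umbrellas: "whitney_umbrella critical_surface p \<and> nontransverse_self_intersection critical_surface p"
    if p: "p \<in> {P1, P2, P3, P4}" for p
  proof -
    obtain \<beta> \<sigma> where s: "\<beta>\<^sup>2 = 1" "\<sigma>\<^sup>2 = 1" and p_eq: "p = vector [0, \<beta> * h, \<sigma> * h, 0]"
      using umbrella_points[OF p] by metis
    have "p \<in> self_intersection_locus critical_surface"
      using meridian_in_locus[OF s, of h] h(1) by (simp add: p_eq sh)
    moreover have "\<not> transverse_self_intersection critical_surface p"
      using s h by (intro not_transverse_pinch) (auto simp: p_eq power_mult_distrib)
    ultimately show ?thesis
      using whitney_umbrella_at[OF s(2,1)] by (simp add: nontransverse_self_intersection_def p_eq)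
  qed
  have poles: "self_intersection_curves_cross_transversely critical_surface p \<and> saddle_self_intersection critical_surface p
      \<and> nontransverse_self_intersection critical_surface p"
    if p: "p \<in> {P5, P6}" for p
  proof -
    obtain \<sigma> where s: "\<sigma>\<^sup>2 = 1" and p_eq: "p = vector [0, 0, \<sigma>, 0]"
      using pole_points[OF p] by metis
    have "p \<in> self_intersection_locus critical_surface"
      using meridian_in_locus[OF s s, of 0] h by (simp add: p_eq)
    moreover have "\<not> transverse_self_intersection critical_surface p"
      using s by (intro not_transverse_pole) (auto simp: p_eq)
    ultimately show ?thesis
      using curves_cross_at_poles[OF s] saddle_at_poles[OF s]
      by (simp add: nontransverse_self_intersection_def p_eq)
  qed
  show ?thesis using lines umbrellas poles by blast
qed

end
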